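(* For $p,q\in\mathcal P$ and $\alpha,\beta\in\mathcal A$ put $$D_0:=\|\mathcal M_{p,\alpha}-\mathcal M_{q,\beta}\|_{L^\infty(0,T)}.$$ There exist constants $D_*>0$ and $C>0$ such that, for all $p,q\in\mathcal P$ and $\alpha,\beta\in\mathcal A$, $$|\alpha-\beta|\le C\,\frac{D_0^{1/2}}{1+|\log D_0|}\qquad\text{whenever }0<D_0\le D_*.$$ In particular, the order is uniquely determined within the admissible class by the scalar observation even though the temporal factor is also unknown: if $p,q\in\mathcal P$, $\alpha,\beta\in\mathcal A$ and $\mathcal M_{p,\alpha}=\mathcal M_{q,\beta}$ on $(0,T)$, then $\alpha=\beta$.
   Context: Let $T>0$ and let $X$ be a separable Hilbert space with inner product $(\cdot,\cdot)_X$ (linear in the first argument) and norm $\|\cdot\|_X$. For $\alpha\in(0,1)$ the fractional Riemann--Liouville integral (Bochner integral) is $J^\alpha w(t):=\frac1{\Gamma(\alpha)}\int_0^t(t-s)^{\alpha-1}w(s)\,ds$, $0<t<T$. It is an injective operator on $L^2(0,T;X)$. Set $\partial_t^\alpha:=(J^\alpha)^{-1}$ with domain $H_\alpha(0,T;X):=J^\alpha L^2(0,T;X)$. Operator: $A:\mathcal D(A)\subset X\to X$ is densely defined, self-adjoint and negative, $-A\ge\lambda_1I$ for some $\lambda_1>0$, and $A$ has compact resolvent. Thus $-A=\sum_{n=1}^\infty\lambda_nP_n$ with $0<\lambda_1<\lambda_2<\cdots$ the distinct eigenvalues and $P_n$ the mutually orthogonal spectral projections. For $a,b>0$, $E_{a,b}(z):=\sum_{k=0}^\infty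 \frac{z^k}{\Gamma(ak+b)}$ is the two-parameter Mittag--Leffler function. Fix constants $0<\alpha_-<\alpha_+<1$, $p_0\ne0$, $M>|p_0|$, and put $\mathcal A:=[\alpha_-,\alpha_+]$, $\mathcal P:=\{p\in C^1[0,T]: p(0)=p_0,\ \|p\|_{C^1[0,T]}\le M\}$ (scalar-valued functions). Fix $f\in X$ and $\psi\in\mathcal D(A)$ with $c_*:=p_0(f,\psi)_X\ne0$. For $p\in\mathcal P$, $\alpha\in\mathcal A$, $u_{p,\alpha}\in H_\alpha(0,T;X)$ denotes the solution of $\partial_t^\alpha u(t)=Au(t)+p(t)f$, $t\in(0,T)$, given by $$u_{p,\alpha}(t)=\sum_{n=1}^\infty\int_0^t(t-s)^{\alpha-1}E_{\alpha,\alpha}\bigl(-\lambda_n(t-s)^\alpha\bigr)p(s)P_nf\,ds,$$ with the series convergent in $H_\alpha(0,T;X)\cap L^2(0,T;\mathcal D(A))$. The scalar observation is $\mathcal M_{p,\alpha}(t):=(u_{p,\alpha}(t),\psi)_X$, $0<t<T$. *)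

theory Defs
  imports "HOL-Analysis.Analysis" "HOL-Probability.Essential_Supremum"
begin

section \<open>Hilbert spaces over the real or the complex numbers\<close>

text \<open>
  The scalar field is either the reals or the complex numbers. The last axiom determines the
  conjugation uniquely: it is the identity on the reals and the usual conjugation on the complex
  numbers, and (Ostrowski, Gelfand-Mazur) these are the only models up to isometric isomorphism.
\<close>

class rc_field = real_normed_field + banach + second_countable_topology +
  fixes conjugate :: "'a \<Rightarrow> 'a"
  assumes conjugate_add: "conjugate (x + y) = conjugate x + conjugate y"
    and mult_conjugate: "x * conjugate x = ((norm x)\<^sup>2) *\<^sub>R 1"

instantiation real :: rc_field
begin
definition conjugate_real :: "real \<Rightarrow> real" where "conjugate_real x = x"
instance by standard (auto simp: conjugate_real_def power2_eq_square)
end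

instantiation complex :: rc_field
begin
definition conjugate_complex :: "complex \<Rightarrow> complex" where "conjugate_complex z = cnj z"
instance
  by standard (auto simp: conjugate_complex_def scaleR_conv_of_real simp flip: complex_norm_square)
end

text \<open>
  Completeness and separability of the Hilbert space are the type classes \<^class>\<open>banach\<close> and
  \<^class>\<open>second_countable_topology\<close>. The real scalar multiplication of the type, which the Bochner
  integral uses, is the restriction of \<open>smul\<close>.
\<close>

locale hilbert_space = vector_space smul
  for smul :: "'k::rc_field \<Rightarrow> 'a::{banach,second_countable_topology} \<Rightarrow> 'a" +
  fixes ip :: "'a \<Rightarrow> 'a \<Rightarrow> 'k"
  assumes scale_of_real: "smul (of_real r) x = r *\<^sub>R x"
    and ip_add_left: "ip (x + y) z = ip x z + ip y z"
    and ip_scale_left: "ip (smul c x) y = c * ip x y"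
    and ip_commute: "ip y x = conjugate (ip x y)"
    and ip_self: "ip x x = of_real ((norm x)\<^sup>2)"


section \<open>The operator\<close>

text \<open>
  An unbounded operator is a domain \<open>D\<close> together with a function \<open>A\<close>, whose values outside \<open>D\<close>
  are irrelevant. The last clause below says that the graph of the adjoint is the graph of \<open>A\<close>.
\<close>

definition self_adjoint ::
  "('k::rc_field \<Rightarrow> 'a::{banach,second_countable_topology} \<Rightarrow> 'a) \<Rightarrow> ('a \<Rightarrow> 'a \<Rightarrow> 'k) \<Rightarrow>
    'a set \<Rightarrow> ('a \<Rightarrow> 'a) \<Rightarrow> bool" where
  "self_adjoint smul ip D A \<longleftrightarrow>
     module.subspace smul D \<and> closure D = UNIV \<and>
     (\<forall>x\<in>D. \<forall>y\<in>D. A (x + y) = A x + A y) \<and>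
     (\<forall>c. \<forall>x\<in>D. A (smul c x) = smul c (A x)) \<and>
     (\<forall>y z. (\<forall>x\<in>D. ip (A x) y = ip x z) \<longleftrightarrow> y \<in> D \<and> z = A y)"

text \<open>\<open>- A \<ge> l I\<close> as quadratic forms.\<close>

definition minus_ge ::
  "('a::{banach,second_countable_topology} \<Rightarrow> 'a \<Rightarrow> 'k::rc_field) \<Rightarrow>
    'a set \<Rightarrow> ('a \<Rightarrow> 'a) \<Rightarrow> real \<Rightarrow> bool" where
  "minus_ge ip D A l \<longleftrightarrow> (\<forall>x\<in>D. \<exists>r. ip (- A x) x = of_real r \<and> l * (norm x)\<^sup>2 \<le> r)"

definition compact_resolvent ::
  "('k::rc_field \<Rightarrow> 'a::{banach,second_countable_topology} \<Rightarrow> 'a) \<Rightarrow>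
    'a set \<Rightarrow> ('a \<Rightarrow> 'a) \<Rightarrow> bool" where
  "compact_resolvent smul D A \<longleftrightarrow>
     (\<exists>\<mu>. bij_betw (\<lambda>x. A x - smul \<mu> x) D UNIV \<and>
          compact (closure (inv_into D (\<lambda>x. A x - smul \<mu> x) ` cball 0 1)))"

definition eigenspace_minus ::
  "('k::rc_field \<Rightarrow> 'a::{banach,second_countable_topology} \<Rightarrow> 'a) \<Rightarrow>
    'a set \<Rightarrow> ('a \<Rightarrow> 'a) \<Rightarrow> 'k \<Rightarrow> 'a set" where
  "eigenspace_minus smul D A \<mu> = {x \<in> D. - A x = smul \<mu> x}"

text \<open>
  \<open>lam 0 < lam 1 < \<dots>\<close> enumerates all distinct eigenvalues of \<open>- A\<close> (so \<open>lam n\<close> is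
  \<open>\<lambda>\<^sub>n\<^sub>+\<^sub>1\<close>), and \<open>P n\<close> is the orthogonal projection onto the eigenspace of \<open>lam n\<close>.
\<close>

definition spectral_system ::
  "('k::rc_field \<Rightarrow> 'a::{banach,second_countable_topology} \<Rightarrow> 'a) \<Rightarrow> ('a \<Rightarrow> 'a \<Rightarrow> 'k) \<Rightarrow>
    'a set \<Rightarrow> ('a \<Rightarrow> 'a) \<Rightarrow> (nat \<Rightarrow> real) \<Rightarrow> (nat \<Rightarrow> 'a \<Rightarrow> 'a) \<Rightarrow> bool" where
  "spectral_system smul ip D A lam P \<longleftrightarrow>
     strict_mono lam \<and>
     range (\<lambda>n. of_real (lam n)) = {\<mu>. \<exists>x\<in>eigenspace_minus smul D A \<mu>. x \<noteq> 0} \<and>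
     (\<forall>n x. P n x \<in> eigenspace_minus smul D A (of_real (lam n)) \<and>
            (\<forall>z\<in>eigenspace_minus smul D A (of_real (lam n)). ip (x - P n x) z = 0))"


section \<open>Function spaces on \<open>(0,T)\<close>\<close>

text \<open>
  Elements of the Lebesgue spaces are represented by functions, with equality almost everywhere.
\<close>

definition L2 :: "real \<Rightarrow> (real \<Rightarrow> 'a::{banach,second_countable_topology}) set" where
  "L2 T = {w \<in> borel_measurable (lebesgue_on {0<..<T}).
             integrable (lebesgue_on {0<..<T}) (\<lambda>t. (norm (w t))\<^sup>2)}"

definition L2_norm :: "real \<Rightarrow> (real \<Rightarrow> 'a::{banach,second_countable_topology}) \<Rightarrow> real" where
  "L2_norm T w = sqrt (LINT t|lebesgue_on {0<..<T}. (norm (w t))\<^sup>2)"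

definition Linf_norm :: "real \<Rightarrow> (real \<Rightarrow> 'a::real_normed_vector) \<Rightarrow> real" where
  "Linf_norm T w = real_of_ereal (esssup (lebesgue_on {0<..<T}) (\<lambda>t. ereal (norm (w t))))"

text \<open>\<open>L\<^sup>2(0,T;D(A))\<close>, where \<open>D(A)\<close> carries the graph norm.\<close>

definition L2_dom ::
  "'a set \<Rightarrow> ('a \<Rightarrow> 'a) \<Rightarrow> real \<Rightarrow> (real \<Rightarrow> 'a::{banach,second_countable_topology}) set" where
  "L2_dom D A T = {w \<in> L2 T. (AE t in lebesgue_on {0<..<T}. w t \<in> D) \<and> (\<lambda>t. A (w t)) \<in> L2 T}"

definition L2_dom_norm ::
  "('a \<Rightarrow> 'a) \<Rightarrow> real \<Rightarrow> (real \<Rightarrow> 'a::{banach,second_countable_topology}) \<Rightarrow> real" where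
  "L2_dom_norm A T w = L2_norm T w + L2_norm T (\<lambda>t. A (w t))"

definition RL_integral ::
  "real \<Rightarrow> (real \<Rightarrow> 'a::{banach,second_countable_topology}) \<Rightarrow> real \<Rightarrow> 'a" where
  "RL_integral \<alpha> w t =
     (1 / Gamma \<alpha>) *\<^sub>R (LINT s:{0<..<t}|lebesgue. ((t - s) powr (\<alpha> - 1)) *\<^sub>R w s)"

definition H_frac ::
  "real \<Rightarrow> real \<Rightarrow> (real \<Rightarrow> 'a::{banach,second_countable_topology}) set" where
  "H_frac \<alpha> T = {v. \<exists>w\<in>L2 T. AE t in lebesgue_on {0<..<T}. v t = RL_integral \<alpha> w t}"

text \<open>
  The inverse of the injective operator \<open>RL_integral \<alpha>\<close> on \<open>L2 T\<close>; the chosen representative is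
  unique up to a null set.
\<close>

definition frac_deriv ::
  "real \<Rightarrow> real \<Rightarrow> (real \<Rightarrow> 'a::{banach,second_countable_topology}) \<Rightarrow> real \<Rightarrow> 'a" where
  "frac_deriv \<alpha> T v =
     (SOME w. w \<in> L2 T \<and> (AE t in lebesgue_on {0<..<T}. v t = RL_integral \<alpha> w t))"

definition H_frac_norm ::
  "real \<Rightarrow> real \<Rightarrow> (real \<Rightarrow> 'a::{banach,second_countable_topology}) \<Rightarrow> real" where
  "H_frac_norm \<alpha> T v = L2_norm T (frac_deriv \<alpha> T v)"

definition C1_norm :: "real \<Rightarrow> (real \<Rightarrow> 'a::real_normed_vector) \<Rightarrow> real" where
  "C1_norm T p = (SUP t\<in>{0..T}. norm (p t)) +
     (SUP t\<in>{0..T}. norm (vector_derivative p (at t within {0..T})))"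

text \<open>Only the values of \<open>p\<close> on \<open>[0,T]\<close> matter; derivatives at the end points are one-sided.\<close>

definition admissible :: "real \<Rightarrow> 'k::real_normed_field \<Rightarrow> real \<Rightarrow> (real \<Rightarrow> 'k) set" where
  "admissible T p0 M =
     {p. (\<forall>t\<in>{0..T}. p differentiable (at t within {0..T})) \<and>
         continuous_on {0..T} (\<lambda>t. vector_derivative p (at t within {0..T})) \<and>
         p 0 = p0 \<and> C1_norm T p \<le> M}"


section \<open>The solution\<close>

definition mittag_leffler :: "real \<Rightarrow> real \<Rightarrow> real \<Rightarrow> real" where
  "mittag_leffler a b z = (\<Sum>k. z ^ k / Gamma (a * real k + b))"

definition mode ::
  "('k::rc_field \<Rightarrow> 'a::{banach,second_countable_topology} \<Rightarrow> 'a) \<Rightarrow> (nat \<Rightarrow> real) \<Rightarrow>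
    (nat \<Rightarrow> 'a \<Rightarrow> 'a) \<Rightarrow> 'a \<Rightarrow> (real \<Rightarrow> 'k) \<Rightarrow> real \<Rightarrow> nat \<Rightarrow> real \<Rightarrow> 'a" where
  "mode smul lam P f p \<alpha> n t =
     (LINT s:{0<..<t}|lebesgue.
        smul (of_real ((t - s) powr (\<alpha> - 1) *
                        mittag_leffler \<alpha> \<alpha> (- lam n * (t - s) powr \<alpha>)) * p s) (P n f))"

text \<open>
  \<open>u\<close> is (a representative of) the solution of \<open>\<partial>\<^sub>t\<^sup>\<alpha> u = A u + p f\<close> in \<open>H_frac \<alpha> T\<close>, and it is the
  sum of the series of modes, which converges in both \<open>H_frac \<alpha> T\<close> and \<open>L2_dom D A T\<close>.
\<close>

definition solution ::
  "('k::rc_field \<Rightarrow> 'a::{banach,second_countable_topology} \<Rightarrow> 'a) \<Rightarrow> 'a set \<Rightarrow> ('a \<Rightarrow> 'a) \<Rightarrow>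
    (nat \<Rightarrow> real) \<Rightarrow> (nat \<Rightarrow> 'a \<Rightarrow> 'a) \<Rightarrow> real \<Rightarrow> 'a \<Rightarrow> (real \<Rightarrow> 'k) \<Rightarrow> real \<Rightarrow> (real \<Rightarrow> 'a) \<Rightarrow> bool"
  where
  "solution smul D A lam P T f p \<alpha> u \<longleftrightarrow>
     u \<in> H_frac \<alpha> T \<inter> L2_dom D A T \<and>
     (AE t in lebesgue_on {0<..<T}. frac_deriv \<alpha> T u t = A (u t) + smul (p t) f) \<and>
     (\<forall>n. mode smul lam P f p \<alpha> n \<in> H_frac \<alpha> T \<inter> L2_dom D A T) \<and>
     (\<lambda>N. H_frac_norm \<alpha> T (\<lambda>t. (\<Sum>n<N. mode smul lam P f p \<alpha> n t) - u t)) \<longlonglongrightarrow> 0 \<and>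
     (\<lambda>N. L2_dom_norm A T (\<lambda>t. (\<Sum>n<N. mode smul lam P f p \<alpha> n t) - u t)) \<longlonglongrightarrow> 0"

definition observation ::
  "('a \<Rightarrow> 'a \<Rightarrow> 'k) \<Rightarrow> 'a \<Rightarrow> (real \<Rightarrow> 'a) \<Rightarrow> real \<Rightarrow> 'k" where
  "observation ip \<psi> u t = ip (u t) \<psi>"

end

theory Submission
  imports Defs
begin

text \<open>
  For small times the observation is \<open>c t powr \<alpha> / Gamma (\<alpha> + 1)\<close> up to an error
  \<open>K t powr (2 \<alpha>)\<close>, where \<open>c = p\<^sub>0 (f, \<psi>) \<noteq> 0\<close> and \<open>K\<close> is the same for the whole admissible class.
  The order is therefore visible in the leading power, and the stability estimate is a quantitative
  version of this.

  The expansion follows from applying \<open>\<psi>\<close> to the equation. As \<open>A\<close> is self-adjoint and \<open>\<psi>\<close> is in its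
  domain, the observation is the fractional integral of order \<open>\<alpha>\<close> of \<open>(u, A \<psi>) + p (f, \<psi>)\<close>. The
  constant \<open>p\<^sub>0 (f, \<psi>)\<close> produces the leading term. The rest is at most a multiple of \<open>s powr \<alpha>\<close>,
  because \<open>p\<close> is Lipschitz and \<open>norm (u s)\<close> is at most a multiple of \<open>s powr \<alpha>\<close>; integrating it
  fractionally yields the error term (\<open>observation_expansion\<close>).

  The bound for \<open>u\<close> has to be uniform over all modes, that is, over all eigenvalues \<open>l\<close>. The kernel
  \<open>e t = t powr (\<alpha> - 1) E (- l t powr \<alpha>)\<close> of a mode, \<open>E\<close> being the Mittag--Leffler function with both
  parameters equal to \<open>\<alpha>\<close>, solves the Volterra equation \<open>e = k - l k * e\<close>, where
  \<open>k t = t powr (\<alpha> - 1) / Gamma \<alpha>\<close> (\<open>relax_kernel_resolvent\<close>). As \<open>k\<close> is log-convex, a first-zero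
  argument shows that \<open>e\<close> is positive (\<open>relax_kernel_pos\<close>), and then \<open>e \<le> k\<close> by the equation. This
  bounds the coefficients of all modes simultaneously, and orthogonality of the eigenspaces turns
  that into the bound for \<open>u\<close> (\<open>solution_norm_le\<close>).

  Let two observations differ by at most \<open>d\<close> and let \<open>\<alpha> < \<beta>\<close>. Dividing by \<open>t powr \<alpha>\<close> leaves an error
  of size \<open>d t powr (- \<alpha>) + t powr \<alpha>\<close>, which at \<open>t = d powr (1 / (2 \<alpha>))\<close> is of the order of \<open>sqrt d\<close>. The
  divided leading terms differ there by at least a multiple of \<open>1 - t powr ((\<beta> - \<alpha>) / 2)\<close>, which forces
  \<open>(\<beta> - \<alpha>) \<bar>ln t\<bar>\<close>, hence \<open>(\<beta> - \<alpha>) \<bar>ln d\<bar>\<close>, to be of the order of \<open>sqrt d\<close> (\<open>order_stability_ordered\<close>).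
\<close>

section \<open>Kernels of fractional integrals\<close>

text \<open>Convolution with this kernel is the fractional integral of order \<open>a\<close>.\<close>

definition frac_kernel :: "real \<Rightarrow> real \<Rightarrow> real" where
  "frac_kernel a t = t powr (a - 1) / Gamma a"

lemma Gamma_real_nonzero: "0 < x \<Longrightarrow> Gamma x \<noteq> (0::real)"
  by (metis Gamma_real_pos less_irrefl)

lemma frac_kernel_nonneg: "0 < a \<Longrightarrow> 0 \<le> frac_kernel a t"
  by (simp add: frac_kernel_def Gamma_real_nonneg)

lemma frac_kernel_pos: "0 < a \<Longrightarrow> 0 < t \<Longrightarrow> 0 < frac_kernel a t"
  by (simp add: frac_kernel_def Gamma_real_pos)

lemma frac_kernel_measurable [measurable]: "frac_kernel a \<in> borel_measurable borel"
  unfolding frac_kernel_def by measurable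

lemma frac_kernel_one: "0 < t \<Longrightarrow> frac_kernel 1 t = 1"
  by (simp add: frac_kernel_def)

lemma has_bochner_integral_Beta:
  assumes "0 < a" "0 < (b::real)"
  shows "has_bochner_integral lebesgue
    (\<lambda>s. indicator {0<..<1} s * (s powr (a - 1) * (1 - s) powr (b - 1))) (Beta a b)"
proof -
  let ?f = "\<lambda>s::real. s powr (a - 1) * (1 - s) powr (b - 1)"
  have ab: "?f absolutely_integrable_on {0..1}"
    by (rule nonnegative_absolutely_integrable_1[OF integrable_Beta'[OF assms]]) auto
  have "has_bochner_integral lebesgue (\<lambda>s. indicator {0..1} s *\<^sub>R ?f s) (Beta a b)"
    using ab set_lebesgue_integral_eq_integral(2)[OF ab] integral_unique[OF has_integral_Beta_real[OF assms]]
    by (simp add: has_bochner_integral_iff set_integrable_def set_lebesgue_integral_def)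
  moreover have "indicator {0..1} s *\<^sub>R ?f s = indicator {0<..<1} s * ?f s" for s
    by (auto simp: indicator_def)
  ultimately show ?thesis by (simp only:)
qed

text \<open>The semigroup law of the kernels; after rescaling to the unit interval it is Euler's Beta
  integral.\<close>

lemma frac_kernel_convolution:
  assumes "0 < a" "0 < b" "0 < t"
  shows "set_integrable lebesgue {0<..<t} (\<lambda>s. frac_kernel a (t - s) * frac_kernel b s)"
    and "(LINT s:{0<..<t}|lebesgue. frac_kernel a (t - s) * frac_kernel b s) = frac_kernel (a + b) t"
proof -
  let ?F = "\<lambda>s. indicator {0<..<t} s * (frac_kernel a (t - s) * frac_kernel b s)"
  have eq: "?F (0 + t * s) = t powr (a + b - 2) / (Gamma a * Gamma b) *
      (indicator {0<..<1} s * (s powr (b - 1) * (1 - s) powr (a - 1)))" for s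
  proof (cases "0 < s \<and> s < 1")
    case True
    have "(t - t * s) powr (a - 1) = t powr (a - 1) * (1 - s) powr (a - 1)"
      using powr_mult[of t "1 - s" "a - 1"] True assms by (simp add: algebra_simps)
    moreover have "(t * s) powr (b - 1) = t powr (b - 1) * s powr (b - 1)"
      using powr_mult[of t s "b - 1"] True assms by simp
    moreover have "t powr (a + b - 2) = t powr (a - 1) * t powr (b - 1)"
      using assms by (simp flip: powr_add add: algebra_simps)
    ultimately show ?thesis using True assms
      by (simp add: frac_kernel_def)
  next
    case False
    then show ?thesis using assms by (auto simp: indicator_def zero_less_mult_iff)
  qed
  have "has_bochner_integral lebesgue (\<lambda>s. ?F (0 + t * s))
      (t powr (a + b - 2) / (Gamma a * Gamma b) * Beta b a)"
    unfolding eq by (intro has_bochner_integral_mult_right has_bochner_integral_Beta assms)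
  also have "t powr (a + b - 2) / (Gamma a * Gamma b) * Beta b a = frac_kernel (a + b) t /\<^sub>R \<bar>t\<bar>"
  proof -
    have "t powr (a + b - 1) = t powr (a + b - 2) * t"
      using assms powr_mult_base[of t "a + b - 2"] by (simp add: algebra_simps)
    moreover have "Gamma a \<noteq> 0" "Gamma b \<noteq> 0" "Gamma (a + b) \<noteq> 0"
      by (intro Gamma_real_nonzero add_pos_pos assms)+
    ultimately show ?thesis using assms
      by (simp add: frac_kernel_def Beta_def field_simps)
  qed
  finally have "has_bochner_integral lebesgue ?F (frac_kernel (a + b) t)"
    using assms by (subst has_bochner_integral_lebesgue_real_affine_iff[of t _ _ 0]) auto
  then show "set_integrable lebesgue {0<..<t} (\<lambda>s. frac_kernel a (t - s) * frac_kernel b s)"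
    and "(LINT s:{0<..<t}|lebesgue. frac_kernel a (t - s) * frac_kernel b s) = frac_kernel (a + b) t"
    by (simp_all add: has_bochner_integral_iff set_integrable_def set_lebesgue_integral_def)
qed

lemma frac_kernel_integral:
  assumes "0 < a" "0 < t"
  shows "set_integrable lebesgue {0<..<t} (\<lambda>s. frac_kernel a (t - s))"
    and "(LINT s:{0<..<t}|lebesgue. frac_kernel a (t - s)) = frac_kernel (a + 1) t"
proof -
  have "set_integrable lebesgue {0<..<t} (\<lambda>s. frac_kernel a (t - s)) =
      set_integrable lebesgue {0<..<t} (\<lambda>s. frac_kernel a (t - s) * frac_kernel 1 s)"
    by (rule set_integrable_cong) (auto simp: frac_kernel_one)
  then show "set_integrable lebesgue {0<..<t} (\<lambda>s. frac_kernel a (t - s))"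
    using frac_kernel_convolution(1)[of a 1 t] assms by simp
  have "(LINT s:{0<..<t}|lebesgue. frac_kernel a (t - s)) =
      (LINT s:{0<..<t}|lebesgue. frac_kernel a (t - s) * frac_kernel 1 s)"
    by (rule set_lebesgue_integral_cong) (auto simp: frac_kernel_one)
  then show "(LINT s:{0<..<t}|lebesgue. frac_kernel a (t - s)) = frac_kernel (a + 1) t"
    using frac_kernel_convolution(2)[of a 1 t] assms by simp
qed

text \<open>For order at most one the kernel is log-convex: the exponent \<open>a - 1\<close> is not positive, and
  \<open>(t1 - s) / (t0 - s) \<ge> t1 / t0\<close>.\<close>

lemma frac_kernel_ratio:
  assumes "0 < a" "a \<le> 1" "0 < s" "s < t0" "t0 \<le> t1"
  shows "frac_kernel a (t1 - s) * frac_kernel a t0 \<le> frac_kernel a t1 * frac_kernel a (t0 - s)"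
proof -
  have "(t0 - s) * t1 \<le> (t1 - s) * t0"
    using assms by (simp add: algebra_simps)
  then have "((t1 - s) * t0) powr (a - 1) \<le> ((t0 - s) * t1) powr (a - 1)"
    using assms by (intro powr_mono2') auto
  then have "(t1 - s) powr (a - 1) * t0 powr (a - 1) \<le> (t0 - s) powr (a - 1) * t1 powr (a - 1)"
    using assms by (simp add: powr_mult)
  then show ?thesis
    using Gamma_real_pos[OF assms(1)]
    by (simp add: frac_kernel_def field_simps)
qed

text \<open>The logarithm of the Gamma function is convex, so its slope on \<open>[x, x + a]\<close> is at least the slope
  on \<open>[x - 1, x]\<close>, which the functional equation evaluates to \<open>ln (x - 1)\<close>. The bound makes the
  Mittag--Leffler series converge everywhere by the ratio test.\<close>

lemma Gamma_quotient_ge: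
  assumes "0 < a" "1 < (x::real)"
  shows "(x - 1) powr a * Gamma x \<le> Gamma (x + a)"
proof -
  have "\<exists>\<xi>>x. \<xi> < x + a \<and> ln_Gamma (x + a) - ln_Gamma x = (x + a - x) * Digamma \<xi>"
    by (rule MVT2) (use assms in \<open>auto intro: has_field_derivative_ln_Gamma_real\<close>)
  then obtain \<xi> where \<xi>: "x < \<xi>" "\<xi> < x + a" and e1: "ln_Gamma (x + a) - ln_Gamma x = a * Digamma \<xi>"
    by auto
  have "\<exists>\<eta>>x - 1. \<eta> < x \<and> ln_Gamma x - ln_Gamma (x - 1) = (x - (x - 1)) * Digamma \<eta>"
    by (rule MVT2) (use assms in \<open>auto intro: has_field_derivative_ln_Gamma_real\<close>)
  then obtain \<eta> where \<eta>: "x - 1 < \<eta>" "\<eta> < x" and e2: "ln_Gamma x - ln_Gamma (x - 1) = Digamma \<eta>"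
    by auto
  have "ln_Gamma x - ln_Gamma (x - 1) = ln (x - 1)"
  proof -
    have "x - 1 \<notin> \<int>\<^sub>\<le>\<^sub>0" using assms by (auto elim!: nonpos_Ints_cases)
    then have "Gamma x = (x - 1) * Gamma (x - 1)"
      using Gamma_plus1[of "x - 1"] by simp
    moreover have "Gamma (x - 1) \<noteq> 0"
      using assms by (simp add: Gamma_real_nonzero)
    ultimately show ?thesis
      using assms by (simp add: ln_Gamma_real_pos ln_mult)
  qed
  moreover have "Digamma \<eta> \<le> Digamma \<xi>"
    using \<xi> \<eta> assms by (intro Digamma_real_mono) auto
  ultimately have "a * ln (x - 1) \<le> ln_Gamma (x + a) - ln_Gamma x"
    using e1 e2 assms by simp
  then have "exp (a * ln (x - 1) + ln_Gamma x) \<le> exp (ln_Gamma (x + a))"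
    by (subst exp_le_cancel_iff) linarith
  then show ?thesis using assms
    by (simp add: Gamma_real_pos_exp exp_add powr_def)
qed

lemma summable_frac_kernel:
  assumes "0 < a" 
  shows "summable (\<lambda>k. norm (z ^ k / Gamma (a * real k + a)))"
proof (cases "z = 0")
  case True
  have "summable (\<lambda>k. norm ((0::real) ^ k / Gamma (a * real k + a)))"
    by (rule summable_finite[of "{0}"]) auto
  then show ?thesis using True by simp
next
  case False
  have "filterlim (\<lambda>k. (a * real k + a - 1) powr a) at_top sequentially"
    using assms by real_asymp
  then obtain N where N: "\<And>k. k \<ge> N \<Longrightarrow> 2 * \<bar>z\<bar> \<le> (a * real k + a - 1) powr a"
    unfolding filterlim_at_top eventually_sequentially by blast
  obtain N' :: nat where N': "1 / a < real N'" using reals_Archimedean2 by blast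
  show ?thesis
  proof (rule summable_ratio_test[where c = "1/2" and N = "max N N'"])
    fix k assume k: "max N N' \<le> k"
    define x where "x = a * real k + a"
    have "1 < a * real k"
      using N' k assms by (simp add: field_simps) (smt (verit) mult_left_mono of_nat_mono)
    then have x: "1 < x" using assms by (simp add: x_def)
    have "2 * \<bar>z\<bar> * Gamma x \<le> Gamma (x + a)"
      using Gamma_quotient_ge[OF assms x] N[of k] k Gamma_real_pos[of x] x
      by (smt (verit) mult_right_mono x_def max.bounded_iff)
    moreover have "Gamma x > 0" "Gamma (x + a) > 0"
      using x assms by (auto intro: Gamma_real_pos)
    ultimately have "\<bar>z\<bar> / Gamma (x + a) \<le> 1/2 * (1 / Gamma x)"
      by (simp add: field_simps)
    then have "\<bar>z\<bar> ^ k * (\<bar>z\<bar> / Gamma (x + a)) \<le> \<bar>z\<bar> ^ k * (1/2 * (1 / Gamma x))"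
      by (rule mult_left_mono) auto
    moreover have "a * real (Suc k) + a = x + a" by (simp add: x_def algebra_simps)
    ultimately show "norm (norm (z ^ Suc k / Gamma (a * real (Suc k) + a)))
        \<le> 1/2 * norm (norm (z ^ k / Gamma (a * real k + a)))"
      using \<open>Gamma x > 0\<close> \<open>Gamma (x + a) > 0\<close>
      by (simp add: x_def[symmetric] power_abs abs_mult mult_ac)
  qed simp
qed

section \<open>Relaxation kernels and the Mittag--Leffler function\<close>

text \<open>The time kernel of a mode with eigenvalue \<open>l\<close>.\<close>

definition relax_kernel :: "real \<Rightarrow> real \<Rightarrow> real \<Rightarrow> real" where
  "relax_kernel a l t = t powr (a - 1) * mittag_leffler a a (- l * t powr a)"

text \<open>As a series in the kernels of the fractional integrals of orders \<open>a, 2 a, 3 a, \<dots>\<close> the relaxation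
  kernel can be convolved term by term with the semigroup law.\<close>

lemma relax_kernel_series:
  assumes "0 < a" "0 < t"
  shows "summable (\<lambda>k. norm ((- l) ^ k * frac_kernel (a * real k + a) t))"
    and "(\<lambda>k. (- l) ^ k * frac_kernel (a * real k + a) t) sums relax_kernel a l t"
proof -
  let ?z = "- l * t powr a"
  have eq: "(- l) ^ k * frac_kernel (a * real k + a) t
      = t powr (a - 1) * (?z ^ k / Gamma (a * real k + a))" for k
  proof -
    have "t powr (a * real k + a - 1) = t powr (a - 1) * t powr (a * real k)"
      by (simp flip: powr_add add: algebra_simps)
    also have "t powr (a * real k) = (t powr a) ^ k"
      using assms by (simp flip: powr_powr add: powr_realpow)
    finally have "t powr (a * real k + a - 1) = t powr (a - 1) * (t powr a) ^ k" .
    then show ?thesis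
      by (simp only: frac_kernel_def power_mult_distrib) simp
  qed
  have "summable (\<lambda>k. t powr (a - 1) * norm (?z ^ k / Gamma (a * real k + a)))"
    by (intro summable_mult summable_frac_kernel assms)
  then show "summable (\<lambda>k. norm ((- l) ^ k * frac_kernel (a * real k + a) t))"
    unfolding eq norm_mult by simp
  have "(\<lambda>k. ?z ^ k / Gamma (a * real k + a)) sums mittag_leffler a a ?z"
    unfolding mittag_leffler_def
    using summable_norm_cancel[OF summable_frac_kernel[OF assms(1), of ?z]] by (rule summable_sums)
  then show "(\<lambda>k. (- l) ^ k * frac_kernel (a * real k + a) t) sums relax_kernel a l t"
    unfolding eq relax_kernel_def by (rule sums_mult)
qed

lemma mittag_leffler_continuous:
  assumes "0 < a"
  shows "isCont (mittag_leffler a a) z"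
proof -
  let ?c = "\<lambda>k. inverse (Gamma (a * real k + a))"
  have "isCont (\<lambda>z. \<Sum>k. ?c k * z ^ k) z"
  proof (rule isCont_powser)
    show "summable (\<lambda>k. ?c k * (\<bar>z\<bar> + 1) ^ k)"
      using summable_norm_cancel[OF summable_frac_kernel[OF assms, of "\<bar>z\<bar> + 1"]]
      by (simp add: field_simps)
    show "norm z < norm (\<bar>z\<bar> + 1)" by simp
  qed
  then show ?thesis
    by (simp add: mittag_leffler_def[abs_def] field_simps)
qed

lemma relax_kernel_continuous:
  assumes "0 < a"
  shows "continuous_on {0<..} (relax_kernel a l)"
proof -
  have "continuous_on UNIV (mittag_leffler a a)"
    by (intro continuous_at_imp_continuous_on ballI mittag_leffler_continuous assms)
  moreover have "continuous_on {0<..} (\<lambda>t. - l * t powr a)"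
    by (intro continuous_on_mult continuous_on_const continuous_on_powr continuous_on_id) auto
  ultimately have "continuous_on {0<..} (\<lambda>t. mittag_leffler a a (- l * t powr a))"
    by (rule continuous_on_compose2) simp
  moreover have "continuous_on {0<..} (\<lambda>t. t powr (a - 1))"
    by (intro continuous_on_const continuous_on_powr continuous_on_id) auto
  ultimately show ?thesis
    unfolding relax_kernel_def[abs_def] by (intro continuous_on_mult)
qed

text \<open>Convolution with \<open>k\<close>, the kernel of the fractional integral, raises the order of every term of the
  series by \<open>a\<close>. Multiplied by \<open>- l\<close> the result is the series without its first term, and that term is
  \<open>k\<close>.\<close>

lemma relax_kernel_resolvent:
  assumes "0 < a" "0 < t"
  shows "set_integrable lebesgue {0<..<t} (\<lambda>s. frac_kernel a (t - s) * relax_kernel a l s)" (is ?I)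
    and "relax_kernel a l t =
      frac_kernel a t - l * (LINT s:{0<..<t}|lebesgue. frac_kernel a (t - s) * relax_kernel a l s)" (is ?E)
proof -
  let ?b = "\<lambda>k. a * real k + a"
  let ?f = "\<lambda>k s. indicator {0<..<t} s *\<^sub>R ((- l) ^ k * (frac_kernel a (t - s) * frac_kernel (?b k) s))"
  have b: "0 < ?b k" for k using assms by (simp add: add_nonneg_pos)
  have suc: "a + ?b k = ?b (Suc k)" for k by (simp add: algebra_simps)
  have int: "integrable lebesgue (?f k)" for k
    using frac_kernel_convolution(1)[OF assms(1) b assms(2), of k]
    unfolding set_integrable_def[symmetric] by (rule set_integrable_mult_right)
  have lint: "integral\<^sup>L lebesgue (?f k) = (- l) ^ k * frac_kernel (?b (Suc k)) t" for k
    using frac_kernel_convolution(2)[OF assms(1) b assms(2), of k]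
    unfolding set_lebesgue_integral_def[symmetric] suc by simp
  have nf: "norm (?f k s) =
      indicator {0<..<t} s *\<^sub>R (\<bar>l\<bar> ^ k * (frac_kernel a (t - s) * frac_kernel (?b k) s))" for k s
    using frac_kernel_nonneg[OF assms(1), of "t - s"] frac_kernel_nonneg[OF b[of k], of s]
    by (simp add: abs_mult power_abs indicator_def)
  have nint: "(\<integral>s. norm (?f k s) \<partial>lebesgue) = \<bar>l\<bar> ^ k * frac_kernel (?b (Suc k)) t" for k
  proof -
    have "(\<integral>s. norm (?f k s) \<partial>lebesgue) = (LINT s:{0<..<t}|lebesgue.
        \<bar>l\<bar> ^ k * (frac_kernel a (t - s) * frac_kernel (?b k) s))"
      unfolding set_lebesgue_integral_def by (simp only: nf)
    also have "\<dots> = \<bar>l\<bar> ^ k * frac_kernel (?b (Suc k)) t"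
      by (simp only: set_integral_mult_right frac_kernel_convolution(2)[OF assms(1) b assms(2)] suc)
    finally show ?thesis .
  qed
  have sums: "(\<lambda>k. ?f k s) sums (indicator {0<..<t} s *\<^sub>R (frac_kernel a (t - s) * relax_kernel a l s))" for s
  proof (cases "s \<in> {0<..<t}")
    case True
    then have "(\<lambda>k. frac_kernel a (t - s) * ((- l) ^ k * frac_kernel (?b k) s))
        sums (frac_kernel a (t - s) * relax_kernel a l s)"
      using assms by (intro sums_mult relax_kernel_series(2)) auto
    with True show ?thesis by (simp add: mult_ac)
  qed simp
  have summ: "AE s in lebesgue. summable (\<lambda>k. norm (?f k s))"
  proof (rule AE_I2)
    fix s
    show "summable (\<lambda>k. norm (?f k s))"
    proof (cases "s \<in> {0<..<t}")
      case True
      then have "summable (\<lambda>k. frac_kernel a (t - s) * norm ((- l) ^ k * frac_kernel (?b k) s))"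
        using assms by (intro summable_mult relax_kernel_series(1)) auto
      with True show ?thesis using frac_kernel_nonneg[OF assms(1), of "t-s"] by (simp add: abs_mult mult_ac)
    qed simp
  qed
  have summint: "summable (\<lambda>k. (\<integral>s. norm (?f k s) \<partial>lebesgue))"
  proof (cases "l = 0")
    case True
    have "summable (\<lambda>k. (0::real) ^ k * frac_kernel (?b (Suc k)) t)"
      by (rule summable_finite[of "{0}"]) auto
    then show ?thesis unfolding nint using True by simp
  next
    case False
    have "summable (\<lambda>k. norm ((- l) ^ Suc k * frac_kernel (?b (Suc k)) t))"
      using relax_kernel_series(1)[OF assms, of l] by (subst summable_Suc_iff)
    then have "summable (\<lambda>k. norm ((- l) ^ Suc k * frac_kernel (?b (Suc k)) t) / \<bar>l\<bar>)"
      by (rule summable_divide)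
    then show ?thesis unfolding nint
      using False frac_kernel_nonneg[OF b] by (simp add: abs_mult power_abs del: of_nat_Suc)
  qed
  note * = integrable_suminf[OF int summ summint] sums_integral[OF int summ summint]
  have sm: "(\<lambda>s. \<Sum>k. ?f k s) = (\<lambda>s. indicator {0<..<t} s *\<^sub>R (frac_kernel a (t - s) * relax_kernel a l s))"
    using sums by (intro ext) (simp only: sums_unique[symmetric])
  show ?I using *(1) unfolding sm set_integrable_def .
  let ?J = "LINT s:{0<..<t}|lebesgue. frac_kernel a (t - s) * relax_kernel a l s"
  have "(\<lambda>k. (- l) ^ k * frac_kernel (?b (Suc k)) t) sums ?J"
    using *(2) unfolding sm lint set_lebesgue_integral_def .
  then have "(\<lambda>k. - l * ((- l) ^ k * frac_kernel (?b (Suc k)) t)) sums (- l * ?J)"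
    by (rule sums_mult)
  then have "(\<lambda>k. (- l) ^ Suc k * frac_kernel (?b (Suc k)) t) sums (- l * ?J)"
    by (simp only: power_Suc mult.assoc)
  then have "(\<lambda>k. (- l) ^ k * frac_kernel (?b k) t) sums (- l * ?J + (- l) ^ 0 * frac_kernel (?b 0) t)"
    by (subst sums_Suc_iff[symmetric]) simp
  from sums_unique2[OF relax_kernel_series(2)[OF assms, of l] this] show ?E
    by simp
qed

text \<open>At a first zero \<open>t1\<close> compare the Volterra equation \<open>e = k - l k * e\<close> with the same equation at
  an earlier time \<open>t0\<close>, chosen as a maximum point of \<open>e\<close> on a short interval before \<open>t1\<close>. By
  log-convexity of \<open>k\<close> the part of the memory integral at \<open>t1\<close> that comes from times before \<open>t0\<close> is at
  most \<open>c = k t1 / k t0\<close> times the memory integral at \<open>t0\<close>, which equals \<open>(k t0 - e t0) / l\<close>. The rest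
  of the memory integral comes from the short interval, on which \<open>e \<le> e t0\<close>, and is too small to
  reduce \<open>c e t0\<close> to zero.\<close>

lemma relax_kernel_pos:
  assumes a: "0 < a" "a \<le> 1" and l: "0 < l" and "0 < t"
  shows "0 < relax_kernel a l t"
proof (rule ccontr)
  let ?e = "relax_kernel a l" and ?k = "frac_kernel a"
  assume neg: "\<not> 0 < ?e t"
  have cont: "continuous_on S ?e" if "S \<subseteq> {0<..}" for S
    using relax_kernel_continuous[OF a(1)] that by (rule continuous_on_subset)
  obtain d where d: "0 < d" "\<And>s. 0 < s \<Longrightarrow> s < d \<Longrightarrow> 0 < ?e s"
  proof -
    have "isCont (mittag_leffler a a) 0" by (rule mittag_leffler_continuous[OF a(1)])
    moreover have "mittag_leffler a a 0 = 1 / Gamma a"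
      unfolding mittag_leffler_def using powser_zero[of "\<lambda>k. inverse (Gamma (a * real k + a))"]
      by (simp add: field_simps)
    moreover have "((\<lambda>s. - l * s powr a) \<longlongrightarrow> - l * 0) (at_right 0)"
      using a by (intro tendsto_intros tendsto_zero_powrI[of _ _ _ a]) (auto simp: eventually_at_filter)
    ultimately have "((\<lambda>s. mittag_leffler a a (- l * s powr a)) \<longlongrightarrow> 1 / Gamma a) (at_right 0)"
      using isCont_tendsto_compose[of 0 "mittag_leffler a a"] by force
    then have "eventually (\<lambda>s. 0 < mittag_leffler a a (- l * s powr a)) (at_right 0)"
      by (rule order_tendstoD) (use Gamma_real_pos[OF a(1)] in simp)
    then obtain d where "0 < d" "\<And>s. 0 < s \<Longrightarrow> s < d \<Longrightarrow> 0 < mittag_leffler a a (- l * s powr a)"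
      unfolding eventually_at_right_field by auto
    then show ?thesis by (intro that[of d]) (auto simp: relax_kernel_def)
  qed
  define S where "S = {s \<in> {d/2..t}. ?e s \<le> 0}"
  have "d \<le> t" using d(2)[of t] neg \<open>0 < t\<close> by force
  then have "t \<in> S" using neg d(1) by (auto simp: S_def)
  have "compact S"
  proof -
    have "S = {d/2..t} \<inter> ?e -` {..0}" by (auto simp: S_def)
    then have "closed S"
      using d(1) by (simp only:) (intro continuous_closed_preimage cont closed_atMost closed_atLeastAtMost, auto)
    moreover have "S \<subseteq> {d/2..t}" by (auto simp: S_def)
    ultimately show ?thesis using compact_Icc bounded_subset compact_eq_bounded_closed by metis
  qed
  then obtain t1 where t1: "t1 \<in> S" "\<And>s. s \<in> S \<Longrightarrow> t1 \<le> s"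
    using \<open>t \<in> S\<close> compact_attains_inf[of S] by blast
  have "0 < t1" "?e t1 \<le> 0" using t1(1) d(1) by (auto simp: S_def)
  have before: "0 < ?e s" if "0 < s" "s < t1" for s
  proof (cases "s < d")
    case False
    then have "s \<notin> S" using t1(2)[of s] that by auto
    then show ?thesis using False that t1(1) d(1) by (auto simp: S_def)
  qed (use d that in auto)
  \<comment> \<open>\<open>h\<close> is so short that \<open>l\<close> times the mass of \<open>k\<close> on \<open>(0, h)\<close> stays below \<open>1 / 2\<close>, the lower
    bound for \<open>c\<close> obtained below.\<close>
  obtain h where h: "0 < h" "h < t1 / 2" "l * frac_kernel (a + 1) h < 1 / 2"
  proof -
    have "((\<lambda>h. l * (h powr a / Gamma (a + 1))) \<longlongrightarrow> l * (0 / Gamma (a + 1))) (at_right 0)"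
      using a Gamma_real_nonzero[of "a + 1"]
      by (intro tendsto_intros tendsto_zero_powrI[of _ _ _ a]) (auto simp: eventually_at_filter)
    then have "eventually (\<lambda>h. l * (h powr a / Gamma (a + 1)) < 1 / 2) (at_right 0)"
      by (rule order_tendstoD) simp
    moreover have "eventually (\<lambda>h. h \<in> {0<..<t1/2}) (at_right 0)"
      using \<open>0 < t1\<close> by (intro eventually_at_right_real) simp
    ultimately have "eventually (\<lambda>h. l * (h powr a / Gamma (a + 1)) < 1 / 2 \<and> h \<in> {0<..<t1/2}) (at_right 0)"
      by (rule eventually_conj)
    then obtain h where "l * (h powr a / Gamma (a + 1)) < 1 / 2" "h \<in> {0<..<t1/2}"
      using eventually_happens[of _ "at_right (0::real)"] by (auto simp: trivial_limit_at_right_real)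
    then show ?thesis by (intro that[of h]) (auto simp: frac_kernel_def)
  qed
  obtain t0 where t0: "t0 \<in> {t1 - h..t1}" "\<And>s. s \<in> {t1 - h..t1} \<Longrightarrow> ?e s \<le> ?e t0"
  proof -
    have "continuous_on {t1 - h..t1} ?e" using h \<open>0 < t1\<close> by (intro cont) auto
    then show ?thesis using continuous_attains_sup[of "{t1 - h..t1}" ?e] h that by auto
  qed
  have "0 < ?e t0" using t0(2)[of "t1 - h"] before[of "t1 - h"] h \<open>0 < t1\<close> by auto
  then have "t0 < t1" "t1 / 2 < t0" "0 < t0" using t0(1) h \<open>?e t1 \<le> 0\<close> by (auto simp: less_le)
  define c where "c = ?k t1 / ?k t0"
  have k0: "0 < ?k t0" and k1: "0 < ?k t1"
    using \<open>0 < t0\<close> \<open>0 < t1\<close> a by (auto intro: frac_kernel_pos)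
  have "0 < c" unfolding c_def using k0 k1 by simp
  have "?k t0 \<le> 2 * ?k t1"
  proof -
    have "t0 powr (a - 1) \<le> (t1 / 2) powr (a - 1)"
      using a \<open>t1 / 2 < t0\<close> \<open>0 < t1\<close> by (intro powr_mono2') auto
    also have "\<dots> = t1 powr (a - 1) * 2 powr (1 - a)"
      using \<open>0 < t1\<close> powr_minus[of 2 "1 - a"] by (simp add: powr_divide field_simps)
    also have "\<dots> \<le> t1 powr (a - 1) * 2 powr 1"
      using a by (intro mult_left_mono powr_mono) auto
    finally show ?thesis using Gamma_real_pos[OF a(1)] by (simp add: frac_kernel_def field_simps)
  qed
  then have c: "1 / 2 \<le> c" using k0 by (simp add: c_def field_simps)
  \<comment> \<open>\<open>?G\<close> is the memory integrand at \<open>t1\<close>, \<open>?A\<close> the one at \<open>t0\<close>, and \<open>?B\<close> is \<open>k\<close> on the short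
    interval from \<open>t0\<close> to \<open>t1\<close>.\<close>
  let ?A = "\<lambda>s. indicator {0<..<t0} s *\<^sub>R (?k (t0 - s) * ?e s)"
  let ?B = "\<lambda>s. indicator {0<..<t1 - t0} (s - t0) *\<^sub>R ?k (t1 - t0 - (s - t0))"
  let ?G = "\<lambda>s. indicator {0<..<t1} s *\<^sub>R (?k (t1 - s) * ?e s)"
  have intA: "integrable lebesgue ?A" "integral\<^sup>L lebesgue ?A = (?k t0 - ?e t0) / l"
    using relax_kernel_resolvent[OF a(1) \<open>0 < t0\<close>, of l] l
    by (auto simp: set_integrable_def set_lebesgue_integral_def field_simps)
  have intG: "integrable lebesgue ?G" "integral\<^sup>L lebesgue ?G = (?k t1 - ?e t1) / l"
    using relax_kernel_resolvent[OF a(1) \<open>0 < t1\<close>, of l] l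
    by (auto simp: set_integrable_def set_lebesgue_integral_def field_simps)
  have "has_bochner_integral lebesgue (\<lambda>s. indicator {0<..<t1 - t0} s *\<^sub>R ?k (t1 - t0 - s))
      (frac_kernel (a + 1) (t1 - t0))"
    using frac_kernel_integral[OF a(1), of "t1 - t0"] \<open>t0 < t1\<close>
    by (simp add: has_bochner_integral_iff set_integrable_def set_lebesgue_integral_def)
  then have intB: "has_bochner_integral lebesgue ?B (frac_kernel (a + 1) (t1 - t0))"
    using has_bochner_integral_lebesgue_real_affine_iff[THEN iffD1, of 1
        "\<lambda>s. indicator {0<..<t1 - t0} s *\<^sub>R ?k (t1 - t0 - s)" "frac_kernel (a + 1) (t1 - t0)" "- t0"]
    by simp
  have "integral\<^sup>L lebesgue ?G \<le> (\<integral>s. c * ?A s + ?e t0 * ?B s \<partial>lebesgue)"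
  proof (rule integral_mono_AE)
    show "integrable lebesgue ?G" by (rule intG)
    show "integrable lebesgue (\<lambda>s. c * ?A s + ?e t0 * ?B s)"
      using intA intB by (intro Bochner_Integration.integrable_add integrable_mult_right)
        (auto simp: has_bochner_integral_iff)
    have "?G s \<le> c * ?A s + ?e t0 * ?B s" if "s \<noteq> t0" for s
    proof -
      consider "s \<le> 0 \<or> t1 \<le> s" | "0 < s" "s < t0" | "t0 < s" "s < t1"
        using \<open>s \<noteq> t0\<close> by linarith
      then show ?thesis
      proof cases
        case 1
        then show ?thesis using \<open>t0 < t1\<close> \<open>0 < t0\<close> by (auto simp: indicator_def)
      next
        case 2
        have "?k (t1 - s) \<le> c * ?k (t0 - s)"
          using frac_kernel_ratio[OF a, of s t0 t1] 2 \<open>t0 < t1\<close> k0 by (simp add: c_def field_simps)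
        then have "?k (t1 - s) * ?e s \<le> c * ?k (t0 - s) * ?e s"
          using before[of s] 2 \<open>t0 < t1\<close> by (intro mult_right_mono) auto
        then show ?thesis using 2 \<open>t0 < t1\<close> by (auto simp: indicator_def)
      next
        case 3
        have "?k (t1 - s) * ?e s \<le> ?k (t1 - s) * ?e t0"
          using 3 t0 by (intro mult_left_mono frac_kernel_nonneg a) auto
        then show ?thesis using 3 \<open>0 < t0\<close> by (auto simp: indicator_def mult_ac)
      qed
    qed
    moreover have "AE s in lebesgue. s \<noteq> t0"
      by (intro AE_completion AE_lborel_singleton)
    ultimately show "AE s in lebesgue. ?G s \<le> c * ?A s + ?e t0 * ?B s"
      by (rule AE_mp[rotated, OF AE_I2[OF impI]])
  qed
  also have "\<dots> = c * ((?k t0 - ?e t0) / l) + ?e t0 * frac_kernel (a + 1) (t1 - t0)"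
    using intA intB
    by (subst Bochner_Integration.integral_add) (auto simp: has_bochner_integral_iff)
  finally have "(?k t1 - ?e t1) / l \<le> c * ((?k t0 - ?e t0) / l) + ?e t0 * frac_kernel (a + 1) (t1 - t0)"
    using intG by simp
  also have "\<dots> = (c * (?k t0 - ?e t0) + ?e t0 * (l * frac_kernel (a + 1) (t1 - t0))) / l"
    using l by (simp add: add_divide_distrib)
  finally have "?k t1 - ?e t1 \<le> c * (?k t0 - ?e t0) + ?e t0 * (l * frac_kernel (a + 1) (t1 - t0))"
    using l by (subst (asm) divide_le_cancel) auto
  moreover have "c * ?k t0 = ?k t1" using k0 by (simp add: c_def)
  ultimately have "c * ?e t0 \<le> ?e t0 * (l * frac_kernel (a + 1) (t1 - t0))"
    using \<open>?e t1 \<le> 0\<close> by (simp add: algebra_simps)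
  then have "c \<le> l * frac_kernel (a + 1) (t1 - t0)" using \<open>0 < ?e t0\<close> by (simp add: mult.commute)
  also have "\<dots> \<le> l * frac_kernel (a + 1) h"
    using t0 l a \<open>t0 < t1\<close> Gamma_real_pos[of "a + 1"]
    by (intro mult_left_mono) (auto simp: frac_kernel_def intro!: divide_right_mono powr_mono2)
  finally show False using c h by simp
qed

text \<open>Positivity of \<open>e\<close> makes the convolution in \<open>e = k - l k * e\<close> nonnegative. The bound does not
  depend on \<open>l\<close>, hence holds for all modes at once.\<close>

lemma relax_kernel_le:
  assumes "0 < a" "a \<le> 1" "0 < l" "0 < t"
  shows "relax_kernel a l t \<le> frac_kernel a t"
proof -
  have "0 \<le> (LINT s:{0<..<t}|lebesgue. frac_kernel a (t - s) * relax_kernel a l s)"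
    unfolding set_lebesgue_integral_def using assms frac_kernel_nonneg[of a] relax_kernel_pos[of a l]
    by (intro integral_nonneg_AE AE_I2) (auto simp: indicator_def less_imp_le)
  then show ?thesis using relax_kernel_resolvent(2)[of a t l] assms by simp
qed

section \<open>Absolute convergence of fractional integrals\<close>

lemma norm_set_integral_le_AE:
  fixes f :: "'b \<Rightarrow> 'c::{banach,second_countable_topology}"
  assumes g: "set_integrable M A g" and le: "AE s in M. s \<in> A \<longrightarrow> norm (f s) \<le> g s"
  shows "norm (LINT s:A|M. f s) \<le> (LINT s:A|M. g s)"
proof -
  let ?F = "\<lambda>s. indicator A s *\<^sub>R f s" and ?G = "\<lambda>s. indicator A s *\<^sub>R g s"
  have le': "AE s in M. norm (?F s) \<le> ?G s"
    using le by eventually_elim (auto simp: indicator_def)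
  show ?thesis
  proof (cases "integrable M ?F")
    case True
    have "norm (integral\<^sup>L M ?F) \<le> (\<integral>s. norm (?F s) \<partial>M)" by (rule integral_norm_bound)
    also have "\<dots> \<le> integral\<^sup>L M ?G"
      using g le' True unfolding set_integrable_def by (intro integral_mono_AE integrable_norm)
    finally show ?thesis unfolding set_lebesgue_integral_def .
  next
    case False
    have "AE s in M. 0 \<le> ?G s"
      using le' by eventually_elim (use norm_ge_zero order_trans in blast)
    then have "0 \<le> integral\<^sup>L M ?G" by (rule integral_nonneg_AE)
    then show ?thesis using False by (simp add: set_lebesgue_integral_def not_integrable_integral_eq)
  qed
qed

lemma AE_lebesgue_on_iff:
  "(AE t in lebesgue_on {0<..<T}. Q t) \<longleftrightarrow> (AE t in lebesgue. t \<in> {0<..<T::real} \<longrightarrow> Q t)"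
  by (rule AE_restrict_space_iff) simp

lemma L2_borel_measurable_indicator:
  assumes "w \<in> L2 T"
  shows "(\<lambda>s. indicator {0<..<T} s *\<^sub>R w s) \<in> borel_measurable lebesgue"
  using assms by (simp add: L2_def borel_measurable_restrict_space_iff)

lemma L2_imp_integrable_norm:
  assumes "w \<in> L2 T"
  shows "integrable (lebesgue_on {0<..<T}) (\<lambda>s. norm (w s))"
proof (rule Bochner_Integration.integrable_bound)
  have "finite_measure (lebesgue_on {0<..<T})"
    by (intro finite_measure_lebesgue_on lmeasurable_open) auto
  then have "integrable (lebesgue_on {0<..<T}) (\<lambda>_. 1 :: real)"
    by (rule finite_measure.integrable_const)
  then show "integrable (lebesgue_on {0<..<T}) (\<lambda>s. 1 + (norm (w s))\<^sup>2)"
    using assms by (intro Bochner_Integration.integrable_add) (auto simp: L2_def)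
  show "(\<lambda>s. norm (w s)) \<in> borel_measurable (lebesgue_on {0<..<T})"
  proof -
    have [measurable]: "w \<in> borel_measurable (lebesgue_on {0<..<T})" using assms by (simp add: L2_def)
    show ?thesis by measurable
  qed
  have "norm (w s) \<le> 1 + (norm (w s))\<^sup>2" for s
    using sum_squares_bound[of 1 "norm (w s)"] zero_le_power2[of "norm (w s)"] norm_ge_zero[of "w s"]
    unfolding one_power2 mult_1_right by linarith
  then show "AE s in lebesgue_on {0<..<T}. norm (norm (w s)) \<le> norm (1 + (norm (w s))\<^sup>2)"
    by (intro AE_I2) (simp add: abs_of_nonneg)
qed

lemma frac_kernel_nn_integral_finite:
  assumes "0 < a"
  shows "(\<integral>\<^sup>+ s. ennreal (indicator {0<..<T} s * frac_kernel a s) \<partial>lborel) < \<infinity>"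
proof (cases "0 < T")
  case True
  have "integrable lebesgue (\<lambda>s. indicator {0<..<T} s *\<^sub>R (frac_kernel 1 (T - s) * frac_kernel a s))"
    using frac_kernel_convolution(1)[of 1 a T] assms True by (simp add: set_integrable_def)
  also have "(\<lambda>s. indicator {0<..<T} s *\<^sub>R (frac_kernel 1 (T - s) * frac_kernel a s)) =
      (\<lambda>s. indicator {0<..<T} s * frac_kernel a s)"
    by (auto simp: indicator_def frac_kernel_one)
  finally have "integrable lborel (\<lambda>s. indicator {0<..<T} s * frac_kernel a s)"
    by (subst (asm) integrable_completion) auto
  then have "(\<integral>\<^sup>+ s. ennreal (norm (indicator {0<..<T} s * frac_kernel a s)) \<partial>lborel) < \<infinity>"
    by (simp add: integrable_iff_bounded)
  then show ?thesis using frac_kernel_nonneg[OF assms] by (simp add: abs_mult)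
qed simp

text \<open>Where the fractional integral does not converge absolutely, the Bochner integral has the default
  value zero, and a functional need not commute with the integral sign. Such times form a null set by
  Tonelli's theorem: integrated over \<open>t\<close>, the fractional integral of the norm of \<open>w\<close> is at most the mass
  of the kernel times the \<open>L\<^sup>1\<close> norm of \<open>w\<close>.\<close>

lemma AE_frac_integral_integrable:
  fixes w :: "real \<Rightarrow> 'c::{banach,second_countable_topology}"
  assumes w: "w \<in> L2 T" and a: "0 < a"
  shows "AE t in lebesgue_on {0<..<T}. set_integrable lebesgue {0<..<t} (\<lambda>s. frac_kernel a (t - s) *\<^sub>R w s)"
proof -
  let ?W = "\<lambda>s. indicator {0<..<T} s *\<^sub>R w s"
  \<comment> \<open>\<open>w\<close> is only Lebesgue measurable, whereas Tonelli's theorem for the product of the Borel measures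
    needs a Borel function: \<open>h\<close> is a Borel version of the norm of \<open>w\<close>.\<close>
  have W: "?W \<in> borel_measurable lebesgue" by (rule L2_borel_measurable_indicator[OF w])
  then have "(\<lambda>s. ennreal (norm (?W s))) \<in> borel_measurable lebesgue" by measurable
  then obtain h where h [measurable]: "h \<in> borel_measurable lborel"
    and h_eq: "AE s in lborel. ennreal (norm (?W s)) = h s"
    using completion_ex_borel_measurable[of "\<lambda>s. ennreal (norm (?W s))" lborel] by auto
  have h_eq': "AE s in lebesgue. ennreal (norm (?W s)) = h s" by (rule AE_completion[OF h_eq])
  have h_fin: "(\<integral>\<^sup>+ s. h s \<partial>lborel) < \<infinity>"
  proof -
    have "(\<integral>\<^sup>+ s. h s \<partial>lborel) = (\<integral>\<^sup>+ s. h s \<partial>lebesgue)" by (rule nn_integral_completion[symmetric])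
    also have "\<dots> = (\<integral>\<^sup>+ s. ennreal (norm (?W s)) \<partial>lebesgue)"
      using h_eq' by (intro nn_integral_cong_AE) auto
    also have "\<dots> < \<infinity>"
    proof -
      have "integrable lebesgue (\<lambda>s. indicator {0<..<T} s *\<^sub>R norm (w s))"
        using L2_imp_integrable_norm[OF w] by (subst (asm) integrable_restrict_space) auto
      then have "integrable lebesgue (\<lambda>s. norm (?W s))" by (simp add: indicator_def)
      then show ?thesis unfolding integrable_iff_bounded by simp
    qed
    finally show ?thesis .
  qed
  let ?\<kappa> = "\<lambda>t s. ennreal (indicator {0<..<T} t * indicator {0<..<t} s * frac_kernel a (t - s))"
  have meas [measurable]: "(\<lambda>(t, s). ?\<kappa> t s * h s) \<in> borel_measurable (lborel \<Otimes>\<^sub>M lborel)"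
  proof -
    have "(\<lambda>(t::real, s). indicator {0<..<t} s :: real) = (\<lambda>x. indicator {x. 0 < snd x \<and> snd x < fst x} x)"
      by (auto simp: indicator_def)
    moreover have "(\<lambda>x::real \<times> real. indicator {x. 0 < snd x \<and> snd x < fst x} x :: real)
        \<in> borel_measurable (lborel \<Otimes>\<^sub>M lborel)" by measurable
    ultimately have [measurable]: "(\<lambda>(t::real, s). indicator {0<..<t} s :: real)
        \<in> borel_measurable (lborel \<Otimes>\<^sub>M lborel)" by simp
    show ?thesis by measurable
  qed
  have [measurable]: "(\<lambda>t. indicator {0<..<t} s :: real) \<in> borel_measurable borel" for s :: real
  proof -
    have "(\<lambda>t. indicator {0<..<t} s :: real) = (\<lambda>t. indicator {0<..} s * indicator {s<..} t)"
      by (auto simp: indicator_def)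
    moreover have "(\<lambda>t. indicator {0<..} s * indicator {s<..} t :: real) \<in> borel_measurable borel"
      by (intro borel_measurable_times borel_measurable_const borel_measurable_indicator) simp
    ultimately show ?thesis by (simp only:)
  qed
  let ?C = "\<integral>\<^sup>+ s. ennreal (indicator {0<..<T} s * frac_kernel a s) \<partial>lborel"
  have inner: "(\<integral>\<^sup>+ t. ?\<kappa> t s \<partial>lborel) \<le> ?C" for s
  proof -
    have "(\<integral>\<^sup>+ t. ?\<kappa> t s \<partial>lborel) = (\<integral>\<^sup>+ r. ?\<kappa> (s + 1 * r) s \<partial>lborel)"
      by (subst nn_integral_real_affine[where c = 1 and t = s]) auto
    also have "\<dots> \<le> ?C"
      using frac_kernel_nonneg[OF a] by (intro nn_integral_mono ennreal_leI) (auto simp: indicator_def)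
    finally show ?thesis .
  qed
  have "(\<integral>\<^sup>+ t. \<integral>\<^sup>+ s. ?\<kappa> t s * h s \<partial>lborel \<partial>lborel) = (\<integral>\<^sup>+ s. \<integral>\<^sup>+ t. ?\<kappa> t s * h s \<partial>lborel \<partial>lborel)"
    using lborel_pair.Fubini'[OF meas] by simp
  also have "\<dots> = (\<integral>\<^sup>+ s. (\<integral>\<^sup>+ t. ?\<kappa> t s \<partial>lborel) * h s \<partial>lborel)"
    by (intro nn_integral_cong nn_integral_multc) measurable
  also have "\<dots> \<le> (\<integral>\<^sup>+ s. ?C * h s \<partial>lborel)"
    by (intro nn_integral_mono mult_right_mono inner) auto
  also have "\<dots> = ?C * (\<integral>\<^sup>+ s. h s \<partial>lborel)" by (rule nn_integral_cmult) measurable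
  also have "\<dots> < \<infinity>"
    using h_fin frac_kernel_nn_integral_finite[OF a, of T] by (simp add: ennreal_mult_less_top)
  finally have "(\<integral>\<^sup>+ t. \<integral>\<^sup>+ s. ?\<kappa> t s * h s \<partial>lborel \<partial>lborel) \<noteq> \<infinity>" by simp
  then have "AE t in lborel. (\<integral>\<^sup>+ s. ?\<kappa> t s * h s \<partial>lborel) \<noteq> \<infinity>"
    by (intro nn_integral_PInf_AE) auto
  then have fin: "AE t in lebesgue. (\<integral>\<^sup>+ s. ?\<kappa> t s * h s \<partial>lborel) \<noteq> \<infinity>"
    by (rule AE_completion)
  have "set_integrable lebesgue {0<..<t} (\<lambda>s. frac_kernel a (t - s) *\<^sub>R w s)"
    if "t \<in> {0<..<T}" "(\<integral>\<^sup>+ s. ?\<kappa> t s * h s \<partial>lborel) \<noteq> \<infinity>" for t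
    unfolding set_integrable_def
  proof (rule integrableI_bounded)
    have eq: "indicator {0<..<t} s *\<^sub>R frac_kernel a (t - s) *\<^sub>R w s =
        (indicator {0<..<t} s * frac_kernel a (t - s)) *\<^sub>R ?W s" for s
      using that(1) by (auto simp: indicator_def)
    have "(\<lambda>s. indicator {0<..<t} s * frac_kernel a (t - s)) \<in> borel_measurable lebesgue"
      by (intro measurable_completion) measurable
    then show "(\<lambda>s. indicator {0<..<t} s *\<^sub>R frac_kernel a (t - s) *\<^sub>R w s) \<in> borel_measurable lebesgue"
      unfolding eq using W by (rule borel_measurable_scaleR)
    have "(\<integral>\<^sup>+ s. ennreal (norm (indicator {0<..<t} s *\<^sub>R frac_kernel a (t - s) *\<^sub>R w s)) \<partial>lebesgue) =
        (\<integral>\<^sup>+ s. ?\<kappa> t s * h s \<partial>lebesgue)"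
    proof (rule nn_integral_cong_AE)
      show "AE s in lebesgue. ennreal (norm (indicator {0<..<t} s *\<^sub>R frac_kernel a (t - s) *\<^sub>R w s)) =
          ?\<kappa> t s * h s"
        using h_eq'
      proof eventually_elim
        case (elim s)
        have "norm (indicator {0<..<t} s *\<^sub>R frac_kernel a (t - s) *\<^sub>R w s) =
            (indicator {0<..<T} t * indicator {0<..<t} s * frac_kernel a (t - s)) * norm (?W s)"
          using that(1) frac_kernel_nonneg[OF a, of "t - s"] by (auto simp: indicator_def)
        then show ?case using frac_kernel_nonneg[OF a, of "t - s"]
          by (simp only: elim[symmetric]) (subst ennreal_mult, auto)
      qed
    qed
    also have "\<dots> = (\<integral>\<^sup>+ s. ?\<kappa> t s * h s \<partial>lborel)" by (rule nn_integral_completion)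
    also have "\<dots> < \<infinity>" using that(2) by (simp add: less_top)
    finally show "(\<integral>\<^sup>+ s. ennreal (norm (indicator {0<..<t} s *\<^sub>R frac_kernel a (t - s) *\<^sub>R w s)) \<partial>lebesgue) < \<infinity>" .
  qed
  then show ?thesis unfolding AE_lebesgue_on_iff using fin by auto
qed

section \<open>Orthogonal expansions in Hilbert spaces\<close>

lemma conjugate_zero [simp]: "conjugate (0::'k::rc_field) = 0"
  using conjugate_add[of 0 "0::'k"] by simp

text \<open>The product axiom determines the conjugate of a nonzero \<open>c\<close> as \<open>(norm c)\<^sup>2 / c\<close>.\<close>

lemma conjugate_scaleR: "conjugate (r *\<^sub>R c) = r *\<^sub>R conjugate (c::'k::rc_field)"
proof (cases "r = 0 \<or> c = 0")
  case False
  have "(r *\<^sub>R c) * conjugate (r *\<^sub>R c) = (r * r) *\<^sub>R (c * conjugate c)"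
    by (simp only: mult_conjugate) (simp add: power2_eq_square)
  also have "\<dots> = (r *\<^sub>R c) * (r *\<^sub>R conjugate c)" by simp
  finally show ?thesis using False by (subst (asm) mult_left_cancel) auto
qed auto

context hilbert_space
begin

lemma ip_zero_left [simp]: "ip 0 y = 0"
  using ip_add_left[of 0 0 y] by simp

lemma ip_zero_right [simp]: "ip x 0 = 0"
  using ip_commute[of x 0] by simp

lemma ip_zero_sym: "ip x y = 0 \<Longrightarrow> ip y x = 0"
  using ip_commute[of y x] by simp

lemma ip_add_right: "ip x (y + z) = ip x y + ip x z"
  using ip_commute[of x] by (simp add: ip_add_left conjugate_add)

lemma ip_scaleR_left: "ip (r *\<^sub>R x) y = r *\<^sub>R ip x y"
  by (simp add: scaleR_conv_of_real ip_scale_left flip: scale_of_real)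

lemma ip_minus_left: "ip (- x) y = - ip x y"
  using ip_scaleR_left[of "-1" x y] by simp

lemma ip_diff_left: "ip (x - z) y = ip x y - ip z y"
  using ip_add_left[of x "- z" y] by (simp add: ip_minus_left)

lemma ip_sum_left: "ip (\<Sum>i\<in>I. g i) y = (\<Sum>i\<in>I. ip (g i) y)"
  by (induction I rule: infinite_finite_induct) (auto simp: ip_add_left)

lemma norm_of_orthogonal_add:
  assumes "ip x y = 0"
  shows "(norm (x + y))\<^sup>2 = (norm x)\<^sup>2 + (norm y)\<^sup>2"
proof -
  have "ip y x = 0" using assms by (rule ip_zero_sym)
  then have "ip (x + y) (x + y) = ip x x + ip y y"
    using assms by (simp add: ip_add_left ip_add_right)
  then have "of_real ((norm (x + y))\<^sup>2) = (of_real ((norm x)\<^sup>2 + (norm y)\<^sup>2) :: 'k)"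
    by (simp add: ip_self)
  then show ?thesis by (simp only: of_real_eq_iff)
qed

lemma norm_conjugate: "norm (conjugate (c::'k)) = norm c"
proof (cases "c = 0")
  case False
  have "norm (c * conjugate c) = (norm c)\<^sup>2"
    by (simp add: mult_conjugate)
  then show ?thesis using False by (simp add: norm_mult power2_eq_square)
qed simp

lemma norm_smul: "norm (smul c x) = norm c * norm x"
proof -
  have "norm (ip (smul c x) (smul c x)) = norm c * norm (ip x (smul c x))"
    by (simp add: ip_scale_left norm_mult)
  also have "ip x (smul c x) = conjugate (c * ip x x)"
    by (subst ip_commute) (simp add: ip_scale_left)
  also have "norm \<dots> = norm c * (norm x)\<^sup>2"
    by (simp add: norm_conjugate norm_mult ip_self norm_power)
  finally have "norm (ip (smul c x) (smul c x)) = (norm c * norm x)\<^sup>2"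
    by (simp add: power2_eq_square mult_ac)
  moreover have "norm (ip (smul c x) (smul c x)) = (norm (smul c x))\<^sup>2"
    by (simp add: ip_self norm_power)
  ultimately have "(norm (smul c x))\<^sup>2 = (norm c * norm x)\<^sup>2" by simp
  then show ?thesis by (simp add: power2_eq_iff_nonneg)
qed

lemma Cauchy_Schwarz: "norm (ip x y) \<le> norm x * norm y"
proof (cases "y = 0")
  case False
  define c where "c = ip x y / of_real ((norm y)\<^sup>2)"
  define z where "z = x - smul c y"
  have "ip z y = 0"
    using False by (simp add: z_def ip_diff_left ip_scale_left ip_self c_def)
  then have "ip (smul c y) z = 0"
    using ip_zero_sym[of z y] by (simp add: ip_scale_left)
  then have "(norm (smul c y + z))\<^sup>2 = (norm (smul c y))\<^sup>2 + (norm z)\<^sup>2"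
    by (rule norm_of_orthogonal_add)
  moreover have "smul c y + z = x" by (simp add: z_def)
  ultimately have "(norm x)\<^sup>2 = (norm (smul c y))\<^sup>2 + (norm z)\<^sup>2"
    by (simp only:)
  then have "(norm (smul c y))\<^sup>2 \<le> (norm x)\<^sup>2"
    using zero_le_power2[of "norm z"] by linarith
  then have "norm (smul c y) \<le> norm x" by (rule power2_le_imp_le) (rule norm_ge_zero)
  moreover have "norm (smul c y) * norm y = norm (ip x y)"
    using False by (simp add: norm_smul c_def norm_divide norm_mult power2_eq_square)
  ultimately show ?thesis by (metis mult_right_mono norm_ge_zero)
qed simp

lemma bounded_linear_ip_left: "bounded_linear (\<lambda>x. ip x y)"
proof (rule bounded_linear_intro)
  show "norm (ip x y) \<le> norm x * norm y" for x by (rule Cauchy_Schwarz)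
qed (auto simp: ip_add_left ip_scaleR_left)

lemma bounded_linear_smul_left: "bounded_linear (\<lambda>c. smul c x)"
proof (rule bounded_linear_intro)
  show "norm (smul c x) \<le> norm c * norm x" for c by (simp add: norm_smul)
  show "smul (r *\<^sub>R c) x = r *\<^sub>R smul c x" for r c
    by (simp add: scaleR_conv_of_real flip: scale_scale scale_of_real)
qed (simp add: scale_left_distrib)

lemma norm_sum_orthogonal:
  assumes "finite I" "\<And>i j. i \<in> I \<Longrightarrow> j \<in> I \<Longrightarrow> i \<noteq> j \<Longrightarrow> ip (x i) (x j) = 0"
  shows "(norm (\<Sum>i\<in>I. x i))\<^sup>2 = (\<Sum>i\<in>I. (norm (x i))\<^sup>2)"
  using assms
proof (induction I rule: finite_induct)
  case (insert i I)
  have "ip (\<Sum>j\<in>I. x j) (x i) = 0"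
    using insert.hyps(2) insert.prems by (auto simp: ip_sum_left intro!: sum.neutral)
  then have "(norm ((\<Sum>j\<in>I. x j) + x i))\<^sup>2 = (norm (\<Sum>j\<in>I. x j))\<^sup>2 + (norm (x i))\<^sup>2"
    by (rule norm_of_orthogonal_add)
  then show ?case using insert by (simp add: add.commute)
qed simp

lemma ip_smul_smul_zero:
  assumes "ip x y = 0"
  shows "ip (smul c x) (smul d y) = 0"
proof -
  have "ip (smul d y) x = 0" using ip_zero_sym[OF assms] by (simp add: ip_scale_left)
  then have "ip x (smul d y) = 0" by (rule ip_zero_sym)
  then show ?thesis by (simp add: ip_scale_left)
qed

text \<open>By Pythagoras the scalars act on the orthogonal components of \<open>f\<close> independently, so their common
  bound factors out and Bessel's inequality estimates the rest.\<close>

lemma norm_multiplier_le: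
  assumes "finite I"
    and orth: "\<And>i j. i \<in> I \<Longrightarrow> j \<in> I \<Longrightarrow> i \<noteq> j \<Longrightarrow> ip (x i) (x j) = 0"
    and proj: "\<And>i. i \<in> I \<Longrightarrow> ip (f - x i) (x i) = 0"
    and c: "\<And>i. i \<in> I \<Longrightarrow> norm (c i) \<le> b" and "0 \<le> b"
  shows "norm (\<Sum>i\<in>I. smul (c i) (x i)) \<le> b * norm f"
proof -
  have s: "(norm (\<Sum>i\<in>I. x i))\<^sup>2 = (\<Sum>i\<in>I. (norm (x i))\<^sup>2)"
    using assms(1) orth by (rule norm_sum_orthogonal)
  have "ip (f - (\<Sum>i\<in>I. x i)) (x j) = 0" if "j \<in> I" for j
  proof -
    have "ip (\<Sum>i\<in>I. x i) (x j) = ip (x j) (x j)"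
      unfolding ip_sum_left using assms(1) that orth
      by (subst sum.remove[of _ j]) (auto intro!: sum.neutral)
    then show ?thesis using proj[OF that] by (simp add: ip_diff_left)
  qed
  then have "ip (x j) (f - (\<Sum>i\<in>I. x i)) = 0" if "j \<in> I" for j
    using ip_zero_sym that by blast
  then have "ip (\<Sum>i\<in>I. x i) (f - (\<Sum>i\<in>I. x i)) = 0"
    by (auto simp: ip_sum_left intro!: sum.neutral)
  then have "(norm ((\<Sum>i\<in>I. x i) + (f - (\<Sum>i\<in>I. x i))))\<^sup>2 =
      (norm (\<Sum>i\<in>I. x i))\<^sup>2 + (norm (f - (\<Sum>i\<in>I. x i)))\<^sup>2"
    by (rule norm_of_orthogonal_add)
  then have bessel: "(\<Sum>i\<in>I. (norm (x i))\<^sup>2) \<le> (norm f)\<^sup>2" using s by simp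
  have "(norm (\<Sum>i\<in>I. smul (c i) (x i)))\<^sup>2 = (\<Sum>i\<in>I. (norm (smul (c i) (x i)))\<^sup>2)"
    using assms(1) orth by (intro norm_sum_orthogonal) (auto intro: ip_smul_smul_zero)
  also have "\<dots> \<le> (\<Sum>i\<in>I. b\<^sup>2 * (norm (x i))\<^sup>2)"
    using c by (intro sum_mono) (auto simp: norm_smul power_mult_distrib intro!: mult_right_mono power_mono)
  also have "\<dots> \<le> b\<^sup>2 * (norm f)\<^sup>2"
    using bessel by (simp add: mult_left_mono flip: sum_distrib_left)
  finally have "(norm (\<Sum>i\<in>I. smul (c i) (x i)))\<^sup>2 \<le> (b * norm f)\<^sup>2"
    by (simp add: power_mult_distrib)
  then show ?thesis by (rule power2_le_imp_le) (use \<open>0 \<le> b\<close> in simp)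
qed

lemma self_adjoint_symmetric:
  assumes "self_adjoint smul ip D A" "x \<in> D" "y \<in> D"
  shows "ip (A x) y = ip x (A y)"
  using assms unfolding self_adjoint_def by blast

text \<open>Moving \<open>A\<close> from one factor to the other multiplies the inner product by \<open>- l\<close> on one side and by
  \<open>- m\<close> on the other.\<close>

lemma eigenspace_orthogonal:
  assumes "self_adjoint smul ip D A"
    and x: "x \<in> eigenspace_minus smul D A (of_real l)"
    and y: "y \<in> eigenspace_minus smul D A (of_real m)" and "l \<noteq> m"
  shows "ip x y = 0"
proof -
  have Ax: "A x = (- l) *\<^sub>R x" and Ay: "A y = (- m) *\<^sub>R y"
    using x y by (simp_all add: eigenspace_minus_def scale_of_real minus_equation_iff[of "A _"])
  have "ip (A x) y = ip x (A y)" using self_adjoint_symmetric[OF assms(1)] x y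
    by (simp add: eigenspace_minus_def)
  moreover have "ip x (A y) = - m *\<^sub>R ip x y"
    using ip_commute[of x "A y"] ip_commute[of x y] by (simp only: Ay ip_scaleR_left conjugate_scaleR)
  ultimately have "(- l) *\<^sub>R ip x y = (- m) *\<^sub>R ip x y"
    by (simp only: Ax ip_scaleR_left)
  then show ?thesis using \<open>l \<noteq> m\<close> by simp
qed

lemma spectral_system_projections:
  assumes sa: "self_adjoint smul ip D A" and ss: "spectral_system smul ip D A lam P"
  shows "i \<noteq> j \<Longrightarrow> ip (P i f) (P j f) = 0" and "ip (f - P i f) (P i f) = 0"
proof -
  show "ip (f - P i f) (P i f) = 0" using ss unfolding spectral_system_def by blast
  assume "i \<noteq> j"
  have "strict_mono lam" using ss unfolding spectral_system_def by blast
  then have "lam i \<noteq> lam j" using \<open>i \<noteq> j\<close> by (simp only: strict_mono_eq[of lam] not_False_eq_True)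
  then show "ip (P i f) (P j f) = 0"
    using ss by (intro eigenspace_orthogonal[OF sa, of _ "lam i" _ "lam j"]) (auto simp: spectral_system_def)
qed

lemma spectral_system_pos:
  assumes "minus_ge ip D A l" "0 < l" and ss: "spectral_system smul ip D A lam P"
  shows "0 < lam n"
proof -
  have "of_real (lam n) \<in> {\<mu>. \<exists>x\<in>eigenspace_minus smul D A \<mu>. x \<noteq> 0}"
    using ss unfolding spectral_system_def by (metis rangeI)
  then obtain x where x: "x \<in> D" "- A x = smul (of_real (lam n)) x" "x \<noteq> 0"
    by (auto simp: eigenspace_minus_def)
  obtain r where r: "ip (- A x) x = of_real r" "l * (norm x)\<^sup>2 \<le> r"
    using assms(1) x(1) unfolding minus_ge_def by blast
  have "of_real r = (of_real (lam n * (norm x)\<^sup>2) :: 'k)"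
    using r(1) by (simp add: x(2) ip_scale_left ip_self)
  then have "r = lam n * (norm x)\<^sup>2" by (simp only: of_real_eq_iff)
  then have "l * (norm x)\<^sup>2 \<le> lam n * (norm x)\<^sup>2" using r(2) by simp
  then have "l \<le> lam n" by (rule mult_right_le_imp_le) (use x(3) in auto)
  with \<open>0 < l\<close> show ?thesis by (rule less_le_trans)
qed

end

section \<open>Small-time behaviour of solutions and observations\<close>

text \<open>All constants below depend on the temporal factor through \<open>p 0\<close> and \<open>M\<close> alone, which is what
  makes the final estimate uniform over the admissible class.\<close>

lemma admissible_bounds:
  fixes p :: "real \<Rightarrow> 'k::rc_field"
  assumes T: "0 < T" and p: "p \<in> admissible T p0 M"
  shows "continuous_on {0..T} p"
    and "t \<in> {0..T} \<Longrightarrow> norm (p t) \<le> M" and "t \<in> {0..T} \<Longrightarrow> norm (p t - p0) \<le> M * t"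
proof -
  let ?p' = "\<lambda>t. vector_derivative p (at t within {0..T})"
  have diff: "p differentiable (at t within {0..T})" if "t \<in> {0..T}" for t
    using p that by (simp add: admissible_def)
  then have vd: "(p has_vector_derivative ?p' t) (at t within {0..T})" if "t \<in> {0..T}" for t
    using that by (simp add: vector_derivative_works)
  show cont: "continuous_on {0..T} p"
    by (intro differentiable_imp_continuous_on) (use diff in \<open>auto simp: differentiable_on_def\<close>)
  have cont': "continuous_on {0..T} ?p'" and C1: "C1_norm T p \<le> M" and "p 0 = p0"
    using p by (auto simp: admissible_def)
  have bdd: "bdd_above ((\<lambda>t. norm (g t)) ` {0..T})" if "continuous_on {0..T} g" for g :: "real \<Rightarrow> 'k"
    by (intro bounded_imp_bdd_above compact_imp_bounded compact_continuous_image
        continuous_on_norm that compact_Icc)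
  have le: "norm (p t) + norm (?p' s) \<le> M" if "t \<in> {0..T}" "s \<in> {0..T}" for s t
    using cSUP_upper[OF that(1) bdd[OF cont]] cSUP_upper[OF that(2) bdd[OF cont']] C1
    unfolding C1_norm_def by linarith
  show "norm (p t) \<le> M" if "t \<in> {0..T}"
    using le[OF that that] norm_ge_zero[of "?p' t"] by linarith
  show "norm (p t - p0) \<le> M * t" if "t \<in> {0..T}"
  proof -
    have "norm (p t - p 0) \<le> M * norm (t - 0)"
    proof (rule differentiable_bound[of "{0..T}"])
      show "(p has_derivative (\<lambda>h. h *\<^sub>R ?p' s)) (at s within {0..T})" if "s \<in> {0..T}" for s
        using vd[OF that] unfolding has_vector_derivative_def .
      show "onorm (\<lambda>h. h *\<^sub>R ?p' s) \<le> M" if "s \<in> {0..T}" for s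
      proof (rule onorm_bound)
        have M: "norm (?p' s) \<le> M"
          using le[OF that that] norm_ge_zero[of "p s"] by linarith
        then show "0 \<le> M" using norm_ge_zero order_trans by blast
        show "norm (h *\<^sub>R ?p' s) \<le> M * norm h" for h
          using mult_right_mono[OF M, of "\<bar>h\<bar>"] by (simp add: mult.commute)
      qed
    qed (use that T in auto)
    then show ?thesis using that \<open>p 0 = p0\<close> by simp
  qed
qed

text \<open>Since \<open>0 < e \<le> k\<close>, the coefficient \<open>e * p\<close> of a mode is bounded by \<open>M\<close> times the integral of
  \<open>k\<close>, whatever the eigenvalue.\<close>

lemma (in hilbert_space) mode_eq_smul:
  assumes T: "0 < T" and p: "p \<in> admissible T p0 M" and a: "0 < a" "a \<le> 1"
    and l: "0 < lam n" and t: "t \<in> {0<..<T}"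
  shows "\<exists>c. norm c \<le> M * frac_kernel (a + 1) t \<and> mode smul lam P f p a n t = smul c (P n f)"
proof -
  let ?g = "\<lambda>s. of_real (relax_kernel a (lam n) (t - s)) * p s"
  have bound: "norm (?g s) \<le> M * frac_kernel a (t - s)" if "s \<in> {0<..<t}" for s
  proof -
    have "norm (?g s) = relax_kernel a (lam n) (t - s) * norm (p s)"
      using relax_kernel_pos[OF a l, of "t - s"] that by (simp add: norm_mult)
    also have "\<dots> \<le> frac_kernel a (t - s) * M"
      using relax_kernel_le[OF a l, of "t - s"] admissible_bounds(2)[OF T p, of s] that t
        frac_kernel_nonneg[OF a(1), of "t - s"]
      by (intro mult_mono) auto
    finally show ?thesis by (simp add: mult.commute)
  qed
  have int_bound: "set_integrable lebesgue {0<..<t} (\<lambda>s. M * frac_kernel a (t - s))"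
    using frac_kernel_integral(1)[OF a(1), of t] t by (intro set_integrable_mult_right) auto
  have "continuous_on {0<..<t} ?g"
  proof (intro continuous_on_mult continuous_on_of_real)
    show "continuous_on {0<..<t} (\<lambda>s. relax_kernel a (lam n) (t - s))"
      by (rule continuous_on_compose2[OF relax_kernel_continuous[OF a(1)]])
        (auto intro!: continuous_intros)
    show "continuous_on {0<..<t} p"
      by (rule continuous_on_subset[OF admissible_bounds(1)[OF T p]]) (use t in auto)
  qed
  then have "(\<lambda>s. indicator {0<..<t} s *\<^sub>R ?g s) \<in> borel_measurable lebesgue"
    by (intro measurable_completion) (simp add: borel_measurable_continuous_on_indicator)
  then have int: "set_integrable lebesgue {0<..<t} ?g"
    using bound by (intro set_integrable_bound[OF int_bound])
      (auto simp: set_borel_measurable_def intro!: AE_I2 intro: order_trans[OF _ abs_ge_self])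
  let ?c = "LINT s:{0<..<t}|lebesgue. ?g s"
  have "norm ?c \<le> (LINT s:{0<..<t}|lebesgue. M * frac_kernel a (t - s))"
    using int_bound bound by (intro norm_set_integral_le_AE) auto
  also have "\<dots> = M * frac_kernel (a + 1) t"
    using frac_kernel_integral(2)[OF a(1), of t] t by simp
  finally have "norm ?c \<le> M * frac_kernel (a + 1) t" .
  moreover have "mode smul lam P f p a n t = smul ?c (P n f)"
  proof -
    have "mode smul lam P f p a n t = (LINT s:{0<..<t}|lebesgue. smul (?g s) (P n f))"
      by (simp add: mode_def relax_kernel_def)
    also have "\<dots> = (\<integral>s. smul (indicator {0<..<t} s *\<^sub>R ?g s) (P n f) \<partial>lebesgue)"
      unfolding set_lebesgue_integral_def
      by (intro Bochner_Integration.integral_cong) (auto simp: indicator_def)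
    also have "\<dots> = smul ?c (P n f)"
      using int unfolding set_integrable_def set_lebesgue_integral_def
      by (rule integral_bounded_linear[OF bounded_linear_smul_left])
    finally show ?thesis .
  qed
  ultimately show ?thesis by blast
qed

lemma L2_add:
  assumes "v \<in> L2 T" "w \<in> L2 T"
  shows "(\<lambda>t. v t + w t) \<in> L2 T"
proof -
  let ?M = "lebesgue_on {0<..<T}"
  have [measurable]: "v \<in> borel_measurable ?M" "w \<in> borel_measurable ?M"
    using assms by (auto simp: L2_def)
  have "integrable ?M (\<lambda>t. 2 * (norm (v t))\<^sup>2 + 2 * (norm (w t))\<^sup>2)"
    using assms by (auto simp: L2_def)
  then have "integrable ?M (\<lambda>t. (norm (v t + w t))\<^sup>2)"
  proof (rule Bochner_Integration.integrable_bound)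
    have "(norm (v t + w t))\<^sup>2 \<le> 2 * (norm (v t))\<^sup>2 + 2 * (norm (w t))\<^sup>2" for t
    proof -
      have "(norm (v t + w t))\<^sup>2 \<le> (norm (v t) + norm (w t))\<^sup>2"
        by (intro power_mono norm_triangle_ineq) simp
      then show ?thesis
        using sum_squares_bound[of "norm (v t)" "norm (w t)"] by (simp add: power2_sum)
    qed
    then show "AE t in ?M. norm ((norm (v t + w t))\<^sup>2) \<le> norm (2 * (norm (v t))\<^sup>2 + 2 * (norm (w t))\<^sup>2)"
      by (intro AE_I2) (simp add: abs_of_nonneg)
  qed measurable
  then show ?thesis by (simp add: L2_def)
qed

lemma L2_uminus: "w \<in> L2 T \<Longrightarrow> (\<lambda>t. - w t) \<in> L2 T"
  by (simp add: L2_def)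

lemma L2_sum:
  assumes "\<And>n. n \<in> I \<Longrightarrow> w n \<in> L2 T"
  shows "(\<lambda>t. \<Sum>n\<in>I. w n t) \<in> L2 T"
  using assms
proof (induction I rule: infinite_finite_induct)
  case (insert i I)
  then show ?case by (simp add: L2_add)
qed (simp_all add: L2_def)

text \<open>The common bound for the coefficients of all modes passes to the partial sums by Bessel's
  inequality, and then to the solution because convergence in \<open>L\<^sup>2\<close> gives a subsequence that converges
  almost everywhere.\<close>

lemma (in hilbert_space) solution_norm_le:
  assumes T: "0 < T" and p: "p \<in> admissible T p0 M" and a: "0 < a" "a \<le> 1"
    and sa: "self_adjoint smul ip D A" and ss: "spectral_system smul ip D A lam P"
    and pos: "\<And>n. 0 < lam n"
    and sol: "solution smul D A lam P T f p a u"
  shows "AE t in lebesgue_on {0<..<T}. norm (u t) \<le> M * norm f * frac_kernel (a + 1) t"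
proof -
  let ?S = "\<lambda>N t. \<Sum>n<N. mode smul lam P f p a n t"
  let ?M = "lebesgue_on {0<..<T}"
  have bound: "norm (?S N t) \<le> M * norm f * frac_kernel (a + 1) t" if t: "t \<in> {0<..<T}" for N t
  proof -
    have "\<forall>n. \<exists>c. norm c \<le> M * frac_kernel (a + 1) t \<and> mode smul lam P f p a n t = smul c (P n f)"
      by (intro allI mode_eq_smul[OF T p a pos t])
    then obtain c where "\<forall>n. norm (c n) \<le> M * frac_kernel (a + 1) t \<and>
        mode smul lam P f p a n t = smul (c n) (P n f)"
      by (rule choice[THEN exE])
    then have c: "norm (c n) \<le> M * frac_kernel (a + 1) t"
      "mode smul lam P f p a n t = smul (c n) (P n f)" for n
      by simp_all
    have "norm (\<Sum>n<N. smul (c n) (P n f)) \<le> (M * frac_kernel (a + 1) t) * norm f"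
    proof (rule norm_multiplier_le)
      show "0 \<le> M * frac_kernel (a + 1) t" using c(1)[of 0] norm_ge_zero order_trans by blast
    qed (use c(1) spectral_system_projections[OF sa ss] in auto)
    then show ?thesis unfolding c(2) by (simp add: mult_ac)
  qed
  have u: "u \<in> L2 T" and modes: "\<And>n. mode smul lam P f p a n \<in> L2 T"
    and lim: "(\<lambda>N. L2_dom_norm A T (\<lambda>t. ?S N t - u t)) \<longlonglongrightarrow> 0"
    using sol unfolding solution_def L2_dom_def by auto
  have L2: "(\<lambda>t. ?S N t - u t) \<in> L2 T" for N
    using L2_add[OF L2_sum[of "{..<N}", OF modes] L2_uminus[OF u]] by simp
  have lim2: "(\<lambda>N. L2_norm T (\<lambda>t. ?S N t - u t)) \<longlonglongrightarrow> 0"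
  proof (rule tendsto_sandwich[OF _ _ tendsto_const lim])
    have nn: "0 \<le> L2_norm T w" for w :: "real \<Rightarrow> 'a"
      unfolding L2_norm_def by (intro real_sqrt_ge_zero integral_nonneg_AE AE_I2) simp
    then show "\<forall>\<^sub>F N in sequentially. 0 \<le> L2_norm T (\<lambda>t. ?S N t - u t)"
      "\<forall>\<^sub>F N in sequentially. L2_norm T (\<lambda>t. ?S N t - u t) \<le> L2_dom_norm A T (\<lambda>t. ?S N t - u t)"
      by (auto simp: L2_dom_norm_def)
  qed
  have "(\<lambda>N. (L2_norm T (\<lambda>t. ?S N t - u t))\<^sup>2) \<longlonglongrightarrow> 0\<^sup>2"
    by (intro tendsto_power lim2)
  moreover have "(L2_norm T (\<lambda>t. ?S N t - u t))\<^sup>2 = (\<integral>t. norm ((norm (?S N t - u t))\<^sup>2) \<partial>?M)" for N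
    unfolding L2_norm_def by (subst real_sqrt_pow2) (auto intro!: integral_nonneg_AE)
  ultimately have "(\<lambda>N. \<integral>t. norm ((norm (?S N t - u t))\<^sup>2) \<partial>?M) \<longlonglongrightarrow> 0" by simp
  moreover have "integrable ?M (\<lambda>t. (norm (?S N t - u t))\<^sup>2)" for N
    using L2[of N] by (simp add: L2_def)
  ultimately obtain r :: "nat \<Rightarrow> nat" where
    ae: "AE t in ?M. (\<lambda>N. (norm (?S (r N) t - u t))\<^sup>2) \<longlonglongrightarrow> 0"
    using tendsto_L1_AE_subseq[of ?M "\<lambda>N t. (norm (?S N t - u t))\<^sup>2"] by blast
  moreover have "AE t in ?M. t \<in> {0<..<T}" by (simp add: AE_lebesgue_on_iff)
  ultimately show ?thesis
  proof eventually_elim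
    case (elim t)
    have "(\<lambda>N. sqrt ((norm (?S (r N) t - u t))\<^sup>2)) \<longlonglongrightarrow> sqrt 0"
      using elim(1) by (rule tendsto_real_sqrt)
    then have "(\<lambda>N. ?S (r N) t - u t) \<longlonglongrightarrow> 0"
      by (simp add: tendsto_norm_zero_iff)
    then have "(\<lambda>N. ?S (r N) t) \<longlonglongrightarrow> u t" by (simp add: LIM_zero_iff)
    then have "(\<lambda>N. norm (?S (r N) t)) \<longlonglongrightarrow> norm (u t)" by (rule tendsto_norm)
    then show ?case by (rule LIMSEQ_le_const2) (use bound elim(2) in blast)
  qed
qed

lemma RL_integral_eq_frac_kernel:
  "RL_integral a w t = (LINT s:{0<..<t}|lebesgue. frac_kernel a (t - s) *\<^sub>R w s)"
  unfolding RL_integral_def frac_kernel_def set_integral_scaleR_right[symmetric]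
  by (simp add: divide_inverse mult.commute)

text \<open>Applying the functional given by \<open>\<psi>\<close> to \<open>u = J w\<close> with \<open>w = A u + p f\<close> and moving \<open>A\<close> to \<open>\<psi>\<close>
  shows that the observation is the fractional integral of \<open>(u, A \<psi>) + p (f, \<psi>)\<close>. At a small time
  \<open>s\<close> this differs from its initial value \<open>p 0 (f, \<psi>)\<close> by a multiple of \<open>s powr a\<close>, which one more
  fractional integration turns into \<open>t powr (2 a)\<close>.\<close>

lemma (in hilbert_space) observation_expansion:
  assumes T: "0 < T" and p: "p \<in> admissible T p0 M" and a: "0 < a" "a \<le> 1"
    and sa: "self_adjoint smul ip D A" and ss: "spectral_system smul ip D A lam P"
    and pos: "\<And>n. 0 < lam n" and \<psi>: "\<psi> \<in> D" and B: "Gamma (a + 1) \<le> B"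
    and sol: "solution smul D A lam P T f p a u"
  shows "AE t in lebesgue_on {0<..<T}.
    norm (observation ip \<psi> u t - p0 * ip f \<psi> * of_real (frac_kernel (a + 1) t)) \<le>
      (M * norm f * norm (A \<psi>) + M * (max 1 T * B) * norm (ip f \<psi>)) * frac_kernel (2 * a + 1) t"
proof -
  let ?K = "M * norm f * norm (A \<psi>) + M * (max 1 T * B) * norm (ip f \<psi>)"
  let ?c = "p0 * ip f \<psi>"
  define w where "w = frac_deriv a T u"
  have "\<exists>w. w \<in> L2 T \<and> (AE t in lebesgue_on {0<..<T}. u t = RL_integral a w t)"
    using sol unfolding solution_def H_frac_def by auto
  from someI_ex[OF this]
  have w: "w \<in> L2 T" and uw: "AE t in lebesgue_on {0<..<T}. u t = RL_integral a w t"
    unfolding w_def frac_deriv_def by simp_all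
  have eqn: "AE t in lebesgue_on {0<..<T}. w t = A (u t) + smul (p t) f"
    and dom: "AE t in lebesgue_on {0<..<T}. u t \<in> D"
    using sol unfolding solution_def L2_dom_def w_def by auto
  have "norm (p 0) \<le> M" using T by (intro admissible_bounds(2)[OF T p]) simp
  then have M: "0 \<le> M" using norm_ge_zero[of "p 0"] by linarith
  have small: "s \<le> (max 1 T * B) * frac_kernel (a + 1) s" if s: "s \<in> {0<..<T}" for s
  proof -
    have "s powr (1 - a) \<le> max 1 T powr (1 - a)" using s a by (intro powr_mono2) auto
    also have "\<dots> \<le> max 1 T powr 1" using a by (intro powr_mono) auto
    finally have "s powr (1 - a) \<le> max 1 T" by simp
    moreover have "1 \<le> B / Gamma (a + 1)" using B Gamma_real_pos[of "a + 1"] a by simp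
    ultimately have "s powr a * (s powr (1 - a) * 1) \<le> s powr a * (max 1 T * (B / Gamma (a + 1)))"
      by (intro mult_left_mono mult_mono) auto
    moreover have "s powr a * s powr (1 - a) = s" using s by (simp flip: powr_add)
    ultimately show ?thesis by (simp add: frac_kernel_def mult_ac)
  qed
  have "AE s in lebesgue_on {0<..<T}. s \<in> {0<..<T}" by (simp add: AE_lebesgue_on_iff)
  with eqn dom solution_norm_le[OF T p a sa ss pos sol]
  have "AE s in lebesgue_on {0<..<T}. norm (ip (w s) \<psi> - ?c) \<le> ?K * frac_kernel (a + 1) s"
  proof eventually_elim
    case (elim s)
    have "ip (w s) \<psi> - ?c = ip (u s) (A \<psi>) + (p s - p0) * ip f \<psi>"
      using elim(1) self_adjoint_symmetric[OF sa elim(2) \<psi>]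
      by (simp add: ip_add_left ip_scale_left algebra_simps)
    then have "norm (ip (w s) \<psi> - ?c) \<le> norm (ip (u s) (A \<psi>)) + norm (p s - p0) * norm (ip f \<psi>)"
      by (simp only: norm_mult[symmetric] norm_triangle_ineq)
    also have "\<dots> \<le> (M * norm f * frac_kernel (a + 1) s) * norm (A \<psi>) +
        (M * ((max 1 T * B) * frac_kernel (a + 1) s)) * norm (ip f \<psi>)"
    proof (rule add_mono)
      show "norm (ip (u s) (A \<psi>)) \<le> (M * norm f * frac_kernel (a + 1) s) * norm (A \<psi>)"
        by (rule order_trans[OF Cauchy_Schwarz mult_right_mono[OF elim(3)]]) simp
      have "norm (p s - p0) \<le> M * s" using admissible_bounds(3)[OF T p, of s] elim(4) by simp
      also have "\<dots> \<le> M * ((max 1 T * B) * frac_kernel (a + 1) s)"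
        using small[OF elim(4)] M by (rule mult_left_mono)
      finally show "norm (p s - p0) * norm (ip f \<psi>) \<le>
          (M * ((max 1 T * B) * frac_kernel (a + 1) s)) * norm (ip f \<psi>)"
        by (rule mult_right_mono) simp
    qed
    also have "\<dots> = ?K * frac_kernel (a + 1) s" by (simp add: algebra_simps)
    finally show ?case .
  qed
  then have close: "AE s in lebesgue. s \<in> {0<..<T} \<longrightarrow>
      norm (ip (w s) \<psi> - ?c) \<le> ?K * frac_kernel (a + 1) s"
    by (simp add: AE_lebesgue_on_iff)
  have "AE s in lebesgue_on {0<..<T}. s \<in> {0<..<T}" by (simp add: AE_lebesgue_on_iff)
  with AE_frac_integral_integrable[OF w a(1)] uw show ?thesis
  proof eventually_elim
    case (elim t)
    let ?I = "\<lambda>s. indicator {0<..<t} s *\<^sub>R frac_kernel a (t - s) *\<^sub>R w s"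
    have t: "0 < t" using elim(3) by simp
    have int: "integrable lebesgue ?I" using elim(1) unfolding set_integrable_def .
    have ipI: "ip (?I s) \<psi> = indicator {0<..<t} s *\<^sub>R frac_kernel a (t - s) *\<^sub>R ip (w s) \<psi>" for s
      by (simp only: ip_scaleR_left)
    have int_w: "set_integrable lebesgue {0<..<t} (\<lambda>s. frac_kernel a (t - s) *\<^sub>R ip (w s) \<psi>)"
      using integrable_bounded_linear[OF bounded_linear_ip_left[of \<psi>] int]
      unfolding ipI set_integrable_def .
    have int_c: "set_integrable lebesgue {0<..<t} (\<lambda>s. frac_kernel a (t - s) *\<^sub>R ?c)"
      using frac_kernel_integral(1)[OF a(1) t] by (intro set_integrable_scaleR_left)
    have "observation ip \<psi> u t = ip (integral\<^sup>L lebesgue ?I) \<psi>"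
      using elim(2) by (simp add: observation_def RL_integral_eq_frac_kernel set_lebesgue_integral_def)
    also have "\<dots> = (LINT s:{0<..<t}|lebesgue. frac_kernel a (t - s) *\<^sub>R ip (w s) \<psi>)"
      using integral_bounded_linear[OF bounded_linear_ip_left[of \<psi>] int]
      unfolding ipI set_lebesgue_integral_def by simp
    finally have obs: "observation ip \<psi> u t =
        (LINT s:{0<..<t}|lebesgue. frac_kernel a (t - s) *\<^sub>R ip (w s) \<psi>)" .
    have "(LINT s:{0<..<t}|lebesgue. frac_kernel a (t - s) *\<^sub>R ?c) =
        (\<integral>s. (indicator {0<..<t} s *\<^sub>R frac_kernel a (t - s)) *\<^sub>R ?c \<partial>lebesgue)"
      by (simp add: set_lebesgue_integral_def)
    also have "\<dots> = (LINT s:{0<..<t}|lebesgue. frac_kernel a (t - s)) *\<^sub>R ?c"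
      using frac_kernel_integral(1)[OF a(1) t] unfolding set_integrable_def set_lebesgue_integral_def
      by (intro integral_scaleR_left)
    also have "\<dots> = ?c * of_real (frac_kernel (a + 1) t)"
      using frac_kernel_integral(2)[OF a(1) t] by (simp add: scaleR_conv_of_real mult.commute)
    finally have c: "?c * of_real (frac_kernel (a + 1) t) =
        (LINT s:{0<..<t}|lebesgue. frac_kernel a (t - s) *\<^sub>R ?c)" by simp
    have diff: "observation ip \<psi> u t - ?c * of_real (frac_kernel (a + 1) t) =
        (LINT s:{0<..<t}|lebesgue. frac_kernel a (t - s) *\<^sub>R ip (w s) \<psi> - frac_kernel a (t - s) *\<^sub>R ?c)"
      unfolding obs c by (rule set_integral_diff(2)[OF int_w int_c, symmetric])
    have "0 < a + 1" using a by simp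
    note conv = frac_kernel_convolution[OF a(1) this t]
    have "norm (observation ip \<psi> u t - ?c * of_real (frac_kernel (a + 1) t)) \<le>
        (LINT s:{0<..<t}|lebesgue. ?K * (frac_kernel a (t - s) * frac_kernel (a + 1) s))"
      unfolding diff
    proof (rule norm_set_integral_le_AE)
      show "set_integrable lebesgue {0<..<t} (\<lambda>s. ?K * (frac_kernel a (t - s) * frac_kernel (a + 1) s))"
        using conv(1) by (rule set_integrable_mult_right)
      show "AE s in lebesgue. s \<in> {0<..<t} \<longrightarrow>
          norm (frac_kernel a (t - s) *\<^sub>R ip (w s) \<psi> - frac_kernel a (t - s) *\<^sub>R ?c) \<le>
          ?K * (frac_kernel a (t - s) * frac_kernel (a + 1) s)"
        using close
      proof eventually_elim
        case (elim s)
        show ?case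
        proof
          assume s: "s \<in> {0<..<t}"
          then have "s \<in> {0<..<T}" using \<open>t \<in> {0<..<T}\<close> by simp
          then have "norm (ip (w s) \<psi> - ?c) \<le> ?K * frac_kernel (a + 1) s" using elim by blast
          then have "frac_kernel a (t - s) * norm (ip (w s) \<psi> - ?c) \<le>
              frac_kernel a (t - s) * (?K * frac_kernel (a + 1) s)"
            by (rule mult_left_mono) (rule frac_kernel_nonneg[OF a(1)])
          moreover have "norm (frac_kernel a (t - s) *\<^sub>R ip (w s) \<psi> - frac_kernel a (t - s) *\<^sub>R ?c) =
              frac_kernel a (t - s) * norm (ip (w s) \<psi> - ?c)"
            using frac_kernel_nonneg[OF a(1), of "t - s"]
            by (simp only: scaleR_diff_right[symmetric] norm_scaleR abs_of_nonneg)
          ultimately show "norm (frac_kernel a (t - s) *\<^sub>R ip (w s) \<psi> - frac_kernel a (t - s) *\<^sub>R ?c) \<le>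
              ?K * (frac_kernel a (t - s) * frac_kernel (a + 1) s)"
            by (simp only: mult.left_commute)
        qed
      qed
    qed
    also have "\<dots> = ?K * frac_kernel (a + (a + 1)) t"
      by (simp only: set_integral_mult_right conv(2))
    also have "a + (a + 1) = 2 * a + 1" by simp
    finally show ?case .
  qed
qed

section \<open>Stability of the leading order\<close>

lemma Gamma_bounds_Icc:
  obtains m B where "0 < m" "\<And>x::real. 1 \<le> x \<Longrightarrow> x \<le> 3 \<Longrightarrow> m \<le> Gamma x" 
    "\<And>x::real. 1 \<le> x \<Longrightarrow> x \<le> 3 \<Longrightarrow> Gamma x \<le> B"
proof -
  have c: "continuous_on {1..3::real} Gamma"
    by (intro continuous_on_Gamma continuous_on_id) (auto elim!: nonpos_Ints_cases)
  obtain x0 where x0: "x0 \<in> {1..3::real}" "\<And>x. x \<in> {1..3} \<Longrightarrow> Gamma x0 \<le> Gamma x"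
    using continuous_attains_inf[OF _ _ c] by auto
  obtain x1 where x1: "x1 \<in> {1..3::real}" "\<And>x. x \<in> {1..3} \<Longrightarrow> Gamma x \<le> Gamma x1"
    using continuous_attains_sup[OF _ _ c] by auto
  show ?thesis
    using x0 x1 Gamma_real_pos[of x0] by (intro that[of "Gamma x0" "Gamma x1"]) auto
qed

text \<open>The digamma function is increasing, so the logarithm of the Gamma function decreases on \<open>[1, \<infinity>)\<close>
  at most at the rate that it has at \<open>1\<close>.\<close>

lemma Gamma_quotient_le_exp:
  assumes "0 \<le> a" "a < (b::real)"
  shows "Gamma (1 + a) \<le> Gamma (1 + b) * exp (\<bar>Digamma 1\<bar> * (b - a))"
proof -
  have "\<exists>\<xi>>1 + a. \<xi> < 1 + b \<and> ln_Gamma (1 + b) - ln_Gamma (1 + a) = (1 + b - (1 + a)) * Digamma \<xi>"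
    by (rule MVT2) (use assms in \<open>auto intro: has_field_derivative_ln_Gamma_real\<close>)
  then obtain \<xi> where \<xi>: "1 + a < \<xi>" "ln_Gamma (1 + b) - ln_Gamma (1 + a) = (b - a) * Digamma \<xi>"
    by auto
  have "- \<bar>Digamma 1\<bar> \<le> Digamma \<xi>"
    using Digamma_real_mono[of 1 \<xi>] \<xi>(1) assms by linarith
  then have "(b - a) * - \<bar>Digamma 1\<bar> \<le> (b - a) * Digamma \<xi>"
    using assms by (intro mult_left_mono) auto
  then have "ln_Gamma (1 + a) \<le> ln_Gamma (1 + b) + \<bar>Digamma 1\<bar> * (b - a)"
    using \<xi>(2) by (simp add: mult.commute)
  then have "exp (ln_Gamma (1 + a)) \<le> exp (ln_Gamma (1 + b) + \<bar>Digamma 1\<bar> * (b - a))"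
    by (subst exp_le_cancel_iff)
  then show ?thesis using assms by (simp add: Gamma_real_pos_exp exp_add)
qed

lemma AE_lebesgue_on_Ioo_ex:
  assumes "AE t in lebesgue_on {0<..<T}. Q t" "0 \<le> a" "a < b" "b \<le> (T::real)"
  obtains t where "a < t" "t < b" "Q t"
proof -
  have "AE t in lebesgue. t \<in> {0<..<T} \<longrightarrow> Q t"
    using assms(1) unfolding AE_lebesgue_on_iff .
  moreover have "\<not> (AE t in lebesgue. t \<notin> {a<..<b})"
  proof
    assume "AE t in lebesgue. t \<notin> {a<..<b}"
    then have "{a<..<b} \<in> null_sets lebesgue" by (subst (asm) AE_iff_null_sets[symmetric]) auto
    then show False using assms(3) by (simp add: null_sets_def)
  qed
  ultimately have "\<exists>t. t \<in> {a<..<b} \<and> Q t"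
  proof -
    have "\<exists>t. \<not> (t \<notin> {a<..<b} \<or> \<not> (t \<in> {0<..<T} \<longrightarrow> Q t))"
    proof (rule ccontr)
      assume "\<not> ?thesis"
      then have *: "\<And>t. (t \<in> {0<..<T} \<longrightarrow> Q t) \<Longrightarrow> t \<notin> {a<..<b}" by blast
      have "AE t in lebesgue. t \<notin> {a<..<b}"
        using \<open>AE t in lebesgue. t \<in> {0<..<T} \<longrightarrow> Q t\<close> by eventually_elim (rule *)
      with \<open>\<not> (AE t in lebesgue. t \<notin> {a<..<b})\<close> show False by blast
    qed
    then show ?thesis using assms by auto
  qed
  then show ?thesis using that by auto
qed

text \<open>Two leading terms \<open>c t powr a / Gamma (1 + a)\<close> and \<open>c t powr b / Gamma (1 + b)\<close> that agree up to
  an error \<open>d + K t powr (2 a)\<close> are compared at a time \<open>t\<close> close to \<open>d powr (1 / (2 a))\<close>, where the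
  two parts of the error balance: after division by \<open>t powr a\<close> both are of size \<open>sqrt d\<close>, whereas
  the difference of the leading terms is at least a multiple of \<open>1 - exp (- x)\<close> with \<open>x\<close> about
  \<open>(b - a) (- ln t)\<close>. The logarithm in the estimate comes from \<open>- ln t\<close>, which is of the order of
  \<open>- ln d\<close>.\<close>

lemma order_stability_ordered:
  fixes c K T am ap :: real
  assumes "0 < T" "0 < c" "0 \<le> K" "0 < am" "ap < 1"
  obtains Ds C where "0 < Ds" "0 < C" and
    "\<And>d a b. 0 < d \<Longrightarrow> d \<le> Ds \<Longrightarrow> am \<le> a \<Longrightarrow> a < b \<Longrightarrow> b \<le> ap \<Longrightarrow>
      (AE t in lebesgue_on {0<..<T}. t \<le> 1 \<longrightarrow>
        c * \<bar>t powr a / Gamma (1 + a) - t powr b / Gamma (1 + b)\<bar> \<le> d + K * t powr (2 * a)) \<Longrightarrow>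
      b - a \<le> C * (d powr (1/2) / (1 + \<bar>ln d\<bar>))"
proof -
  obtain m B where mB: "0 < m" "\<And>x::real. 1 \<le> x \<Longrightarrow> x \<le> 3 \<Longrightarrow> m \<le> Gamma x"
    "\<And>x::real. 1 \<le> x \<Longrightarrow> x \<le> 3 \<Longrightarrow> Gamma x \<le> B" using Gamma_bounds_Icc by blast
  have "0 < B" using mB(1) mB(2)[of 1] mB(3)[of 1] by simp
  define L where "L = \<bar>Digamma (1::real)\<bar>"
  define E where "E = (B / c) * (2 + K)"
  have "0 \<le> L" by (simp add: L_def)
  have "0 < E" using \<open>0 < B\<close> assms by (simp add: E_def)
  \<comment> \<open>\<open>r\<close> bounds \<open>sqrt d\<close> and with it the comparison time \<open>t\<close>. The four terms ensure, in this order,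
    that \<open>t < T\<close>, that \<open>- ln t\<close> is at least twice the loss \<open>L\<close> from the Gamma factors, that
    \<open>- ln d \<ge> 2\<close>, and that the error relative to the leading term is at most \<open>1 / 2\<close>.\<close>
  define r where "r = min (min T (exp (- 2 * L))) (min (exp (- 1)) (1 / (2 * E)))"
  have r: "0 < r" "r \<le> T" "r \<le> exp (- 2 * L)" "r \<le> exp (- 1)" "r \<le> 1 / (2 * E)"
    using assms \<open>0 < E\<close> by (auto simp: r_def)
  have "exp (- 1) < (1::real)" by simp
  then have "r < 1" using r(4) by linarith
  have main: "b - a \<le> 16 * E * (d powr (1/2) / (1 + \<bar>ln d\<bar>))"
    if d: "0 < d" "d \<le> r\<^sup>2" and ab: "am \<le> a" "a < b" "b \<le> ap"
    and ae: "AE t in lebesgue_on {0<..<T}. t \<le> 1 \<longrightarrow>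
        c * \<bar>t powr a / Gamma (1 + a) - t powr b / Gamma (1 + b)\<bar> \<le> d + K * t powr (2 * a)" for d a b
  proof -
    have a: "0 < a" "a < 1" using ab assms by auto
    define w where "w = d powr (1/2)"
    have w: "0 < w" "w \<le> r" "w * w = d"
    proof -
      show "0 < w" using d by (simp add: w_def)
      show "w \<le> r" using d r(1) real_le_lsqrt[of r d] by (simp add: w_def powr_half_sqrt)
      show "w * w = d" using d by (simp add: w_def flip: powr_add)
    qed
    define t1 where "t1 = w powr (1 / a)"
    have t1: "0 < t1" "t1 \<le> w" "t1 powr a = w"
    proof -
      show "0 < t1" using w by (simp add: t1_def)
      show "t1 powr a = w" using w a by (simp add: t1_def powr_powr)
      have "w powr (1 / a) \<le> w powr 1"
        using w \<open>r < 1\<close> a by (intro powr_mono') (auto simp: field_simps)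
      then show "t1 \<le> w" using w by (simp add: t1_def)
    qed
    \<comment> \<open>The estimate is known for almost every time only, so \<open>t1\<close> itself need not be usable. Moving
      down by at most a factor \<open>2\<close> changes the powers by bounded factors.\<close>
    obtain t where t: "t1 / 2 < t" "t < t1" and tb: "t \<le> 1 \<longrightarrow>
        c * \<bar>t powr a / Gamma (1 + a) - t powr b / Gamma (1 + b)\<bar> \<le> d + K * t powr (2 * a)"
      using AE_lebesgue_on_Ioo_ex[OF ae, of "t1 / 2" t1] t1 w r by auto
    have "0 < t" "t < r" using t t1 w by auto
    have G: "0 < Gamma (1 + a)" "0 < Gamma (1 + b)" "Gamma (1 + a) \<le> B"
      using a ab assms mB(3)[of "1 + a"] by (auto intro!: Gamma_real_pos)
    have ta: "0 < t powr a" "t powr a \<le> w" "w \<le> 2 * t powr a"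
    proof -
      show "0 < t powr a" using \<open>0 < t\<close> by simp
      show "t powr a \<le> w" using t \<open>0 < t\<close> a t1 powr_mono2[of a t t1] by simp
      have "w = 2 powr a * (t1 / 2) powr a" using t1 by (simp add: powr_divide)
      also have "\<dots> \<le> 2 powr 1 * t powr a"
        using t t1 a by (intro mult_mono powr_mono powr_mono2) auto
      finally show "w \<le> 2 * t powr a" by simp
    qed
    define x where "x = (b - a) * (- ln t - L)"
    have lnt: "2 * L \<le> - ln t" "1 \<le> - ln t"
      using \<open>0 < t\<close> \<open>t < r\<close> r(1,3,4) ln_le_cancel_iff[of t "exp (- 2 * L)"] ln_le_cancel_iff[of t "exp (- 1)"]
      by auto
    have tba: "t powr (b - a) * Gamma (1 + a) \<le> Gamma (1 + b) * exp (- x)"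
    proof -
      have "t powr (b - a) * Gamma (1 + a) \<le>
          exp ((b - a) * ln t) * (Gamma (1 + b) * exp (L * (b - a)))"
        using Gamma_quotient_le_exp[of a b] a ab \<open>0 < t\<close>
        by (auto simp: powr_def L_def intro!: mult_mono)
      also have "\<dots> = Gamma (1 + b) * exp (- x)"
        by (simp add: x_def algebra_simps flip: exp_add)
      finally show ?thesis .
    qed
    have "(1 - exp (- x)) / B \<le> (1 - exp (- x)) / Gamma (1 + a)"
    proof (rule divide_left_mono)
      have "0 \<le> x" using ab lnt \<open>0 \<le> L\<close> by (simp add: x_def)
      then show "0 \<le> 1 - exp (- x)" by simp
    qed (use G in auto)
    also have "\<dots> \<le> 1 / Gamma (1 + a) - t powr (b - a) / Gamma (1 + b)"
      using tba G by (simp add: field_simps)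
    also have "\<dots> = (t powr a / Gamma (1 + a) - t powr b / Gamma (1 + b)) / t powr a"
      using ta by (simp add: powr_diff field_simps)
    also have "\<dots> \<le> ((d + K * t powr (2 * a)) / c) / t powr a"
    proof (rule divide_right_mono)
      have "c * (t powr a / Gamma (1 + a) - t powr b / Gamma (1 + b)) \<le> d + K * t powr (2 * a)"
        using tb \<open>t < r\<close> \<open>r < 1\<close> assms(2)
        by (smt (verit) mult_left_mono)
      then show "t powr a / Gamma (1 + a) - t powr b / Gamma (1 + b) \<le> (d + K * t powr (2 * a)) / c"
        using assms(2) by (simp add: field_simps)
    qed (use ta in auto)
    also have "\<dots> = (w * (w / t powr a) + K * t powr a) / c"
    proof -
      have "t powr (2 * a) = t powr a * t powr a" by (simp flip: powr_add)
      then show ?thesis using ta assms(2) w(3) by (simp add: field_simps)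
    qed
    also have "\<dots> \<le> (w * 2 + K * w) / c"
      using ta w assms by (intro divide_right_mono add_mono mult_left_mono) (auto simp: field_simps)
    finally have "1 - exp (- x) \<le> E * w"
      using \<open>0 < B\<close> assms by (simp add: E_def field_simps)
    moreover have "E * w \<le> 1 / 2"
      using w(2) r(5) \<open>0 < E\<close> by (simp add: field_simps)
        (smt (verit) mult_left_mono)
    ultimately have "1 - E * w \<le> exp (- x)" "1 / 2 \<le> 1 - E * w" by auto
    moreover have "x * exp (- x) \<le> 1 - exp (- x)"
      using exp_ge_add_one_self[of x] mult_right_mono[of "1 + x" "exp x" "exp (- x)"]
      by (simp add: algebra_simps exp_minus_inverse)
    moreover have "0 \<le> x" using ab lnt \<open>0 \<le> L\<close> by (simp add: x_def)
    ultimately have "x \<le> 2 * (E * w)"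
      using \<open>1 - exp (- x) \<le> E * w\<close> mult_left_mono[of "1/2" "exp (- x)" x] by auto
    moreover have "(b - a) * (- ln t / 2) \<le> x"
      unfolding x_def using lnt ab by (intro mult_left_mono) auto
    ultimately have X: "(b - a) * (- ln t) \<le> 4 * (E * w)" by simp
    have "ln d = 2 * ln w" using w ln_mult[of w w] by simp
    moreover have "ln t \<le> ln w" using \<open>0 < t\<close> t t1 w by simp
    moreover have "ln w \<le> -1" using w r(4) ln_le_cancel_iff[of w "exp (- 1)"] by auto
    ultimately have "1 + \<bar>ln d\<bar> \<le> 4 * (- ln t)" by auto
    then have "(b - a) * (1 + \<bar>ln d\<bar>) \<le> (b - a) * (4 * (- ln t))"
      using ab by (intro mult_left_mono) auto
    also have "\<dots> = 4 * ((b - a) * (- ln t))" by simp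
    also have "\<dots> \<le> 4 * (4 * (E * w))" using X by (intro mult_left_mono) auto
    also have "\<dots> = 16 * E * w" by simp
    finally show ?thesis unfolding w_def[symmetric]
      by (simp add: field_simps)
  qed
  show ?thesis
    by (rule that[of "r\<^sup>2" "16 * E"]) (use r(1) \<open>0 < E\<close> main in auto)
qed

text \<open>The two observations are treated symmetrically, so the preceding estimate applies to whichever
  of the orders is smaller. On \<open>t \<le> 1\<close> both remainders are bounded by the power with the smaller
  exponent.\<close>

lemma order_stability:
  fixes c :: "'k::real_normed_field" and K T am ap :: real
  assumes "0 < T" "c \<noteq> 0" "0 \<le> K" "0 < am" "ap < 1"
  obtains Ds C where "0 < Ds" "0 < C" and
    "\<And>d a b g h. 0 < d \<Longrightarrow> d \<le> Ds \<Longrightarrow> a \<in> {am..ap} \<Longrightarrow> b \<in> {am..ap} \<Longrightarrow>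
      (AE t in lebesgue_on {0<..<T}.
        norm (g t - c * of_real (frac_kernel (a + 1) t)) \<le> K * t powr (2 * a)) \<Longrightarrow>
      (AE t in lebesgue_on {0<..<T}.
        norm (h t - c * of_real (frac_kernel (b + 1) t)) \<le> K * t powr (2 * b)) \<Longrightarrow>
      (AE t in lebesgue_on {0<..<T}. norm (g t - h t) \<le> d) \<Longrightarrow>
      \<bar>a - b\<bar> \<le> C * (d powr (1/2) / (1 + \<bar>ln d\<bar>))"
proof -
  have "0 < norm c" "0 \<le> 2 * K" using assms by auto
  from order_stability_ordered[OF assms(1) this assms(4,5)] obtain Ds C where Ds: "0 < Ds" "0 < C"
    and main: "\<And>d a b. 0 < d \<Longrightarrow> d \<le> Ds \<Longrightarrow> am \<le> a \<Longrightarrow> a < b \<Longrightarrow> b \<le> ap \<Longrightarrow>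
      (AE t in lebesgue_on {0<..<T}. t \<le> 1 \<longrightarrow>
        norm c * \<bar>t powr a / Gamma (1 + a) - t powr b / Gamma (1 + b)\<bar> \<le> d + 2 * K * t powr (2 * a)) \<Longrightarrow>
      b - a \<le> C * (d powr (1/2) / (1 + \<bar>ln d\<bar>))" by blast
  have ordered: "b - a \<le> C * (d powr (1/2) / (1 + \<bar>ln d\<bar>))"
    if d: "0 < d" "d \<le> Ds" and ab: "a \<in> {am..ap}" "b \<in> {am..ap}" "a < b"
      and g: "AE t in lebesgue_on {0<..<T}.
        norm (g t - c * of_real (frac_kernel (a + 1) t)) \<le> K * t powr (2 * a)"
      and h: "AE t in lebesgue_on {0<..<T}.
        norm (h t - c * of_real (frac_kernel (b + 1) t)) \<le> K * t powr (2 * b)"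
      and gh: "AE t in lebesgue_on {0<..<T}. norm (g t - h t) \<le> d" for d a b and g h :: "real \<Rightarrow> 'k"
  proof (rule main[OF d])
    have "AE t in lebesgue_on {0<..<T}. t \<in> {0<..<T}" by (simp add: AE_lebesgue_on_iff)
    with g h gh show "AE t in lebesgue_on {0<..<T}. t \<le> 1 \<longrightarrow>
        norm c * \<bar>t powr a / Gamma (1 + a) - t powr b / Gamma (1 + b)\<bar> \<le> d + 2 * K * t powr (2 * a)"
    proof eventually_elim
      case (elim t)
      show ?case
      proof
        assume "t \<le> 1"
        define x y where "x = frac_kernel (a + 1) t" and "y = frac_kernel (b + 1) t"
        have "t powr (2 * b) \<le> t powr (2 * a)"
          using elim(4) \<open>t \<le> 1\<close> \<open>a < b\<close> by (intro powr_mono') auto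
        then have Kb: "K * t powr (2 * b) \<le> K * t powr (2 * a)"
          using assms(3) by (rule mult_left_mono)
        have "c * of_real x - c * of_real y =
            - (g t - c * of_real x) + (h t - c * of_real y) + (g t - h t)"
          by simp
        then have "norm (c * of_real x - c * of_real y) \<le>
            norm (g t - c * of_real x) + norm (h t - c * of_real y) + norm (g t - h t)"
          by (metis norm_triangle_mono norm_minus_cancel order_refl)
        also have "\<dots> \<le> d + 2 * K * t powr (2 * a)"
          using elim(1-3) Kb unfolding x_def y_def by linarith
        also have "norm (c * of_real x - c * of_real y) = norm c * \<bar>x - y\<bar>"
          by (simp only: right_diff_distrib[symmetric] of_real_diff[symmetric] norm_mult norm_of_real)
        finally show "norm c * \<bar>t powr a / Gamma (1 + a) - t powr b / Gamma (1 + b)\<bar> \<le>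
            d + 2 * K * t powr (2 * a)"
          by (simp add: x_def y_def frac_kernel_def add.commute)
      qed
    qed
  qed (use ab in auto)
  show ?thesis
  proof (rule that[OF Ds])
    fix d a b and g h :: "real \<Rightarrow> 'k"
    assume d: "0 < d" "d \<le> Ds" and ab: "a \<in> {am..ap}" "b \<in> {am..ap}"
      and g: "AE t in lebesgue_on {0<..<T}.
        norm (g t - c * of_real (frac_kernel (a + 1) t)) \<le> K * t powr (2 * a)"
      and h: "AE t in lebesgue_on {0<..<T}.
        norm (h t - c * of_real (frac_kernel (b + 1) t)) \<le> K * t powr (2 * b)"
      and gh: "AE t in lebesgue_on {0<..<T}. norm (g t - h t) \<le> d"
    have hg: "AE t in lebesgue_on {0<..<T}. norm (h t - g t) \<le> d"
      using gh by (simp add: norm_minus_commute)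
    consider "a < b" | "b < a" | "a = b" by linarith
    then show "\<bar>a - b\<bar> \<le> C * (d powr (1/2) / (1 + \<bar>ln d\<bar>))"
    proof cases
      case 1
      then show ?thesis using ordered[OF d ab 1 g h gh] by simp
    next
      case 2
      then show ?thesis using ordered[OF d ab(2,1) 2 h g hg] by simp
    next
      case 3
      then show ?thesis using Ds by simp
    qed
  qed
qed

text \<open>An essential supremum that is infinite, in particular that of a non-measurable function, is
  turned into the real number zero; positivity excludes this case.\<close>

lemma Linf_norm_pos_AE:
  assumes "0 < Linf_norm T g"
  shows "AE t in lebesgue_on {0<..<T}. norm (g t) \<le> Linf_norm T g"
proof -
  let ?e = "esssup (lebesgue_on {0<..<T}) (\<lambda>t. ereal (norm (g t)))"
  have "?e = ereal (Linf_norm T g)"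
    using assms unfolding Linf_norm_def by (cases ?e) auto
  then show ?thesis
    using esssup_AE[where M = "lebesgue_on {0<..<T}" and f = "\<lambda>t. ereal (norm (g t))"] by simp
qed

theorem corollary4p3:
  fixes smul :: "'k::rc_field \<Rightarrow> 'a::{banach,second_countable_topology} \<Rightarrow> 'a"
    and ip :: "'a \<Rightarrow> 'a \<Rightarrow> 'k"
    and D :: "'a set" and A :: "'a \<Rightarrow> 'a"
    and lam :: "nat \<Rightarrow> real" and P :: "nat \<Rightarrow> 'a \<Rightarrow> 'a"
    and T \<alpha>m \<alpha>p M :: real and p0 :: 'k and f \<psi> :: 'a
  assumes "hilbert_space smul ip"
    and "T > 0"
    and "self_adjoint smul ip D A"
    and "\<exists>l>0. minus_ge ip D A l"
    and "compact_resolvent smul D A"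
    and "spectral_system smul ip D A lam P"
    and "0 < \<alpha>m" and "\<alpha>m < \<alpha>p" and "\<alpha>p < 1"
    and "p0 \<noteq> 0" and "M > norm p0"
    and "\<psi> \<in> D" and "p0 * ip f \<psi> \<noteq> 0"
  shows
    "(\<exists>Dstar>0. \<exists>C>0.
        \<forall>p\<in>admissible T p0 M. \<forall>q\<in>admissible T p0 M. \<forall>\<alpha>\<in>{\<alpha>m..\<alpha>p}. \<forall>\<beta>\<in>{\<alpha>m..\<alpha>p}. \<forall>u v.
          solution smul D A lam P T f p \<alpha> u \<longrightarrow> solution smul D A lam P T f q \<beta> v \<longrightarrow>
          (let D0 = Linf_norm T (\<lambda>t. observation ip \<psi> u t - observation ip \<psi> v t)
           in 0 < D0 \<and> D0 \<le> Dstar \<longrightarrow> \<bar>\<alpha> - \<beta>\<bar> \<le> C * (D0 powr (1/2) / (1 + \<bar>ln D0\<bar>)))) \<and>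
     (\<forall>p\<in>admissible T p0 M. \<forall>q\<in>admissible T p0 M. \<forall>\<alpha>\<in>{\<alpha>m..\<alpha>p}. \<forall>\<beta>\<in>{\<alpha>m..\<alpha>p}. \<forall>u v.
          solution smul D A lam P T f p \<alpha> u \<longrightarrow> solution smul D A lam P T f q \<beta> v \<longrightarrow>
          (AE t in lebesgue_on {0<..<T}. observation ip \<psi> u t = observation ip \<psi> v t) \<longrightarrow>
          \<alpha> = \<beta>)"
proof -
  interpret hilbert_space smul ip by fact
  obtain l where l: "0 < l" "minus_ge ip D A l" using assms(4) by blast
  have pos: "0 < lam n" for n by (rule spectral_system_pos[OF l(2,1) assms(6)])
  obtain m B where mB: "0 < m" "\<And>x::real. 1 \<le> x \<Longrightarrow> x \<le> 3 \<Longrightarrow> m \<le> Gamma x"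
    "\<And>x::real. 1 \<le> x \<Longrightarrow> x \<le> 3 \<Longrightarrow> Gamma x \<le> B" using Gamma_bounds_Icc by blast
  have "0 < B" using mB(1) mB(2)[of 1] mB(3)[of 1] by simp
  have "0 < M" using assms(11) norm_ge_zero[of p0] by linarith
  define c where "c = p0 * ip f \<psi>"
  define K0 where "K0 = M * norm f * norm (A \<psi>) + M * (max 1 T * B) * norm (ip f \<psi>)"
  have "0 \<le> K0"
    using \<open>0 < M\<close> \<open>0 < B\<close> unfolding K0_def by (intro add_nonneg_nonneg mult_nonneg_nonneg) auto
  define K where "K = K0 / m"
  have "0 \<le> K" using \<open>0 \<le> K0\<close> mB(1) by (simp add: K_def)
  have expansion: "AE t in lebesgue_on {0<..<T}.
      norm (observation ip \<psi> u t - c * of_real (frac_kernel (\<alpha> + 1) t)) \<le> K * t powr (2 * \<alpha>)"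
    if p: "p \<in> admissible T p0 M" and \<alpha>: "\<alpha> \<in> {\<alpha>m..\<alpha>p}"
      and sol: "solution smul D A lam P T f p \<alpha> u" for p \<alpha> u
  proof -
    have a: "0 < \<alpha>" "\<alpha> \<le> 1" using \<alpha> assms by auto
    have B: "Gamma (\<alpha> + 1) \<le> B" using a by (intro mB(3)) auto
    have G: "m \<le> Gamma (2 * \<alpha> + 1)" using a by (intro mB(2)) auto
    have "K0 * frac_kernel (2 * \<alpha> + 1) t \<le> K * t powr (2 * \<alpha>)" for t
    proof -
      have "t powr (2 * \<alpha>) / Gamma (2 * \<alpha> + 1) \<le> t powr (2 * \<alpha>) / m"
        using G mB(1) by (intro divide_left_mono mult_pos_pos) auto
      then have "K0 * (t powr (2 * \<alpha>) / Gamma (2 * \<alpha> + 1)) \<le> K0 * (t powr (2 * \<alpha>) / m)"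
        using \<open>0 \<le> K0\<close> by (rule mult_left_mono)
      then show ?thesis by (simp add: frac_kernel_def K_def)
    qed
    note le = order_trans[OF _ this]
    from observation_expansion[OF assms(2) p a assms(3,6) pos assms(12) B sol]
    show ?thesis unfolding c_def[symmetric] K0_def[symmetric]
      by eventually_elim (rule le)
  qed
  obtain Ds C where Ds: "0 < Ds" "0 < C" and
    main: "\<And>d a b g h. 0 < d \<Longrightarrow> d \<le> Ds \<Longrightarrow> a \<in> {\<alpha>m..\<alpha>p} \<Longrightarrow> b \<in> {\<alpha>m..\<alpha>p} \<Longrightarrow>
      (AE t in lebesgue_on {0<..<T}.
        norm (g t - c * of_real (frac_kernel (a + 1) t)) \<le> K * t powr (2 * a)) \<Longrightarrow>
      (AE t in lebesgue_on {0<..<T}.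
        norm (h t - c * of_real (frac_kernel (b + 1) t)) \<le> K * t powr (2 * b)) \<Longrightarrow>
      (AE t in lebesgue_on {0<..<T}. norm (g t - h t) \<le> d) \<Longrightarrow>
      \<bar>a - b\<bar> \<le> C * (d powr (1/2) / (1 + \<bar>ln d\<bar>))"
    using order_stability[OF assms(2) assms(13)[folded c_def] \<open>0 \<le> K\<close> assms(7,9)] by blast
  have both: "(let D0 = Linf_norm T (\<lambda>t. observation ip \<psi> u t - observation ip \<psi> v t)
      in 0 < D0 \<and> D0 \<le> Ds \<longrightarrow> \<bar>\<alpha> - \<beta>\<bar> \<le> C * (D0 powr (1/2) / (1 + \<bar>ln D0\<bar>))) \<and>
      ((AE t in lebesgue_on {0<..<T}. observation ip \<psi> u t = observation ip \<psi> v t) \<longrightarrow> \<alpha> = \<beta>)"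
    if pq: "p \<in> admissible T p0 M" "q \<in> admissible T p0 M"
      and \<alpha>\<beta>: "\<alpha> \<in> {\<alpha>m..\<alpha>p}" "\<beta> \<in> {\<alpha>m..\<alpha>p}"
      and sol: "solution smul D A lam P T f p \<alpha> u" "solution smul D A lam P T f q \<beta> v"
    for p q \<alpha> \<beta> u v
  proof (intro conjI impI)
    note exps = expansion[OF pq(1) \<alpha>\<beta>(1) sol(1)] expansion[OF pq(2) \<alpha>\<beta>(2) sol(2)]
    show "let D0 = Linf_norm T (\<lambda>t. observation ip \<psi> u t - observation ip \<psi> v t)
      in 0 < D0 \<and> D0 \<le> Ds \<longrightarrow> \<bar>\<alpha> - \<beta>\<bar> \<le> C * (D0 powr (1/2) / (1 + \<bar>ln D0\<bar>))"
      unfolding Let_def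
      by (intro impI main[OF _ _ \<alpha>\<beta> exps] Linf_norm_pos_AE) auto
    assume eq: "AE t in lebesgue_on {0<..<T}. observation ip \<psi> u t = observation ip \<psi> v t"
    \<comment> \<open>The estimate holds for every positive bound \<open>d\<close> of the difference, not only for its norm.
      Coinciding observations allow \<open>d\<close> to be arbitrarily small.\<close>
    show "\<alpha> = \<beta>"
    proof (rule ccontr)
      assume "\<alpha> \<noteq> \<beta>"
      then have e: "0 < \<bar>\<alpha> - \<beta>\<bar>" by simp
      define r where "r = \<bar>\<alpha> - \<beta>\<bar> / (2 * C)"
      define d where "d = min Ds (r\<^sup>2)"
      have "0 < r" using e Ds by (simp add: r_def)
      then have d: "0 < d" "d \<le> Ds" "d \<le> r\<^sup>2" using Ds by (auto simp: d_def)
      have "AE t in lebesgue_on {0<..<T}. norm (observation ip \<psi> u t - observation ip \<psi> v t) \<le> d"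
        using eq by eventually_elim (use d in simp)
      then have "\<bar>\<alpha> - \<beta>\<bar> \<le> C * (d powr (1/2) / (1 + \<bar>ln d\<bar>))"
        by (rule main[OF d(1,2) \<alpha>\<beta> exps])
      also have "\<dots> \<le> C * (r / 1)"
      proof (intro mult_left_mono frac_le)
        have "sqrt d \<le> sqrt (r\<^sup>2)" using d(3) by (rule real_sqrt_le_mono)
        then show "d powr (1/2) \<le> r" using d(1) \<open>0 < r\<close> by (simp add: powr_half_sqrt)
      qed (use Ds \<open>0 < r\<close> in auto)
      also have "\<dots> = \<bar>\<alpha> - \<beta>\<bar> / 2" using Ds by (simp add: r_def)
      finally have "\<bar>\<alpha> - \<beta>\<bar> \<le> \<bar>\<alpha> - \<beta>\<bar> / 2" .
      then show False using e by (simp add: field_simps)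
    qed
  qed
  show ?thesis
    by (intro conjI exI[of _ Ds] exI[of _ C] ballI allI impI Ds both[THEN conjunct1]
        both[THEN conjunct2, THEN mp])
qed

end
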